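(* Let $n$ be an upper bound on the stream length, given to the algorithm in advance. Let $0<\delta\le 0.5$ and $0<\varepsilon\le 1$ satisfy $\delta>1/\exp(\varepsilon n/64)$, and set $$k=2\left\lceil \frac{4}{\varepsilon}\sqrt{\frac{\ln(1/\delta)}{\log_2(\varepsilon n)}}\right\rceil.$$ Then for any fixed item $y$, the Relative-Error Quantiles sketch with parameters $k$ and $n$ computes an estimate $\hat{\operatorname{R}}(y)$ of $\operatorname{R}(y)$ whose error $\mathrm{Err}(y)=\hat{\operatorname{R}}(y)-\operatorname{R}(y)$ satisfies $\Pr[|\mathrm{Err}(y)|\ge\varepsilon\operatorname{R}(y)]<3\delta$. If $\varepsilon\le 4\sqrt{\ln(1/\delta)/\log_2(\varepsilon n)}$, the memory used by the algorithm is $O\big(\varepsilon^{-1}\log^{1.5}(\varepsilon n)\sqrt{\log(1/\delta)}\big)$; otherwise the algorithm uses $O(\log^2(\varepsilon n))$ memory words.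
   Context: Items come from a totally ordered universe $\mathcal{U}$; for a multiset/sequence $X$ and $y\in\mathcal{U}$, $\operatorname{R}(y;X)=|\{x\in X: x\le y\}|$, and $\operatorname{R}(y)$ is the rank of $y$ in the input stream. A relative-compactor with parameters an even positive integer $k$ and $n$ keeps a buffer of capacity $B=2k\lceil\log_2(n/k)\rceil$ and an integer state $C$, initially $0$. When an item arrives: if the buffer currently holds $B$ items, a compaction is performed: let $z(C)$ be the number of trailing ones in the binary representation of $C$, let $L=(z(C)+1)k$; take the $L$ largest items in the buffer, sort them in non-descending order, and with probability $1/2$ (independently of everything else) output the items at the odd positions of this sorted block, otherwise those at the even positions; remove all these $L$ items from the buffer and increase $C$ by $1$. Then the arriving item is stored in the buffer. The Relative-Error Quantiles sketch with parameters $k,n$ consists of relative-compactors at levels $0,1,2,\dots$ (all with parameters $k,n$): the input stream is fed to level $0$; the items output by the level-$h$ compactor are fed, one by one, as input to the level-$(h+1)$ compactor, which is created when level $h$ first outputs items. The estimate $\hat{\operatorname{R}}(y)$ is $\sum_h 2^h\cdot(\text{number of items }\le y\text{ stored in the level-}h\text{ buffer})$. Memory is measured in words, each storing an item or an $O(\log(n+|\mathcal{U}|))$-bit integer.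
   Formalization: The error bound is stated only for items y with R(y) ≥ 1, since for R(y)=0 the error is 0, the event 0 ≥ 0 has probability 1, and the claim fails for δ ≤ 1/3; the O-constant is chosen for the given universe of items. *)

theory Defs
  imports "HOL-Probability.Probability"
begin

definition item_rank :: "'a::linorder \<Rightarrow> 'a multiset \<Rightarrow> nat" where
  "item_rank y X = size {#x \<in># X. x \<le> y#}"

record 'a compactor =
  buffer :: "'a multiset"
  state :: nat

definition new_compactor :: "'a compactor" where
  "new_compactor = \<lparr>buffer = {#}, state = 0\<rparr>"

definition capacity :: "nat \<Rightarrow> nat \<Rightarrow> nat" where
  "capacity k n = 2 * k * nat \<lceil>log 2 (real n / real k)\<rceil>"

function trailing_ones :: "nat \<Rightarrow> nat" where
  "trailing_ones C = (if odd C then Suc (trailing_ones (C div 2)) else 0)"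
  by auto
termination by (relation "Wellfounded.measure id") (auto elim: oddE)

declare trailing_ones.simps [simp del]

text \<open>Positions in the sorted block are counted from one, list indices from zero: the items at
  odd positions are those at even indices.\<close>

definition compact :: "nat \<Rightarrow> bool \<Rightarrow> 'a::linorder compactor \<Rightarrow> 'a compactor \<times> 'a list" where
  "compact k coin c =
     (let L = (trailing_ones (state c) + 1) * k;
          s = sorted_list_of_multiset (buffer c);
          kept = take (length s - L) s;
          block = drop (length s - L) s
      in (\<lparr>buffer = mset kept, state = state c + 1\<rparr>,
          nths block {i. if coin then even i else odd i}))"

text \<open>The state of a compactor is the number of compactions it has performed, so it
  serves as index of the coin flip that is used by the next one.\<close>

definition arrive ::
    "nat \<Rightarrow> nat \<Rightarrow> (nat \<Rightarrow> bool) \<Rightarrow> 'a::linorder compactor \<Rightarrow> 'a \<Rightarrow> 'a compactor \<times> 'a list" where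
  "arrive k n coins c x =
     (let (c', out) = (if size (buffer c) = capacity k n
                       then compact k (coins (state c)) c else (c, []))
      in (c'\<lparr>buffer := add_mset x (buffer c')\<rparr>, out))"

primrec run ::
    "nat \<Rightarrow> nat \<Rightarrow> (nat \<Rightarrow> bool) \<Rightarrow> 'a::linorder compactor \<Rightarrow> 'a list \<Rightarrow> 'a compactor \<times> 'a list" where
  "run k n coins c [] = (c, [])"
| "run k n coins c (x # xs) =
     (let (c', out) = arrive k n coins c x;
          (c'', out') = run k n coins c' xs
      in (c'', out @ out'))"

text \<open>The sketch is a function of the stream and of the coin flips, where \<open>\<omega> (h, i)\<close> decides
  the compaction number \<open>i\<close> of level \<open>h\<close>. A compactor depends on the rest of the sketch only
  through the sequence of its input items, so the levels can be described one after the other.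
  The state of the sketch at an earlier time is the one obtained from a prefix of the stream
  with the same coin flips.\<close>

primrec level_input :: "nat \<Rightarrow> nat \<Rightarrow> (nat \<times> nat \<Rightarrow> bool) \<Rightarrow> 'a::linorder list \<Rightarrow> nat \<Rightarrow> 'a list" where
  "level_input k n \<omega> xs 0 = xs"
| "level_input k n \<omega> xs (Suc h) =
     snd (run k n (\<lambda>i. \<omega> (h, i)) new_compactor (level_input k n \<omega> xs h))"

definition level :: "nat \<Rightarrow> nat \<Rightarrow> (nat \<times> nat \<Rightarrow> bool) \<Rightarrow> 'a::linorder list \<Rightarrow> nat \<Rightarrow> 'a compactor" where
  "level k n \<omega> xs h = fst (run k n (\<lambda>i. \<omega> (h, i)) new_compactor (level_input k n \<omega> xs h))"

definition levels :: "nat \<Rightarrow> nat \<Rightarrow> (nat \<times> nat \<Rightarrow> bool) \<Rightarrow> 'a::linorder list \<Rightarrow> nat set" where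
  "levels k n \<omega> xs = {h. h = 0 \<or> level_input k n \<omega> xs h \<noteq> []}"

definition estimate :: "nat \<Rightarrow> nat \<Rightarrow> (nat \<times> nat \<Rightarrow> bool) \<Rightarrow> 'a::linorder list \<Rightarrow> 'a \<Rightarrow> nat" where
  "estimate k n \<omega> xs y =
     (\<Sum>h\<in>levels k n \<omega> xs. 2 ^ h * item_rank y (buffer (level k n \<omega> xs h)))"

definition Err :: "nat \<Rightarrow> nat \<Rightarrow> (nat \<times> nat \<Rightarrow> bool) \<Rightarrow> 'a::linorder list \<Rightarrow> 'a \<Rightarrow> real" where
  "Err k n \<omega> xs y = real (estimate k n \<omega> xs y) - real (item_rank y (mset xs))"

definition coin_flips :: "(nat \<times> nat \<Rightarrow> bool) measure" where
  "coin_flips = (\<Pi>\<^sub>M p\<in>UNIV. measure_pmf (bernoulli_pmf (1/2)))"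

text \<open>Words of \<open>log 2 (n + 1)\<close> bits; the least number of words for an integer is one.\<close>

definition int_words :: "nat \<Rightarrow> nat \<Rightarrow> nat" where
  "int_words n m = max 1 (nat \<lceil>log 2 (real m + 1) / log 2 (real n + 1)\<rceil>)"

text \<open>A compactor is charged for all slots of its buffer, whether or not they are in use (and
  for the items actually stored, should they exceed the capacity), for its state, and for the
  arriving item, which must be held during a compaction. Output items that wait for being fed
  to the next level fit into the slots they have just left.\<close>

definition compactor_words :: "nat \<Rightarrow> nat \<Rightarrow> 'a compactor \<Rightarrow> nat" where
  "compactor_words k n c = max (capacity k n) (size (buffer c)) + 1 + int_words n (state c)"

definition memory_words :: "nat \<Rightarrow> nat \<Rightarrow> (nat \<times> nat \<Rightarrow> bool) \<Rightarrow> 'a::linorder list \<Rightarrow> nat" where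
  "memory_words k n \<omega> xs =
     int_words n k + int_words n n + (\<Sum>h\<in>levels k n \<omega> xs. compactor_words k n (level k n \<omega> xs h))"


text \<open>The sums over the set of levels are meaningful because it is finite.\<close>

lemma length_nths_parity:
  assumes "even (length xs)"
  shows "2 * length (nths xs {i. if b then even i else odd i}) = length xs"
  using assms
proof (induction xs rule: induct_list012)
  case (3 x y zs)
  have eq: "{j. Suc (Suc j) \<in> {i. if b then even i else odd i}} = {i. if b then even i else odd i}"
    by auto
  have "length (nths (x # y # zs) {i. if b then even i else odd i})
      = Suc (length (nths zs {i. if b then even i else odd i}))"
    using eq by (cases b) (simp_all add: nths_Cons)
  with 3 show ?case by simp
qed auto

lemma length_arrive:
  assumes "even k" "arrive k n coins c x = (c', out)"
  shows "size (buffer c') + 2 * length out = Suc (size (buffer c))"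
proof (cases "size (buffer c) = capacity k n")
  case True
  define L where "L = (trailing_ones (state c) + 1) * k"
  define s where "s = sorted_list_of_multiset (buffer c)"
  have ms: "mset s = buffer c" by (simp add: s_def)
  have len: "length s = size (buffer c)" using arg_cong[OF ms, of size] by simp
  have "even (length s)" "even L" using True assms by (auto simp: len capacity_def L_def)
  then have ev: "even (length (drop (length s - L) s))"
    by (cases "L \<le> length s") auto
  have "out = nths (drop (length s - L) s) {i. if coins (state c) then even i else odd i}"
    and "buffer c' = add_mset x (mset (take (length s - L) s))"
    using assms True by (auto simp: arrive_def compact_def Let_def L_def s_def)
  then show ?thesis using length_nths_parity[OF ev] len by simp
next
  case False
  then show ?thesis using assms by (auto simp: arrive_def)
qed

lemma length_run:
  assumes "even k" "run k n coins c xs = (c', out)"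
  shows "size (buffer c') + 2 * length out = size (buffer c) + length xs"
  using assms(2)
proof (induction xs arbitrary: c out)
  case (Cons x xs)
  obtain c1 o1 where a: "arrive k n coins c x = (c1, o1)" by fastforce
  obtain c2 o2 where r: "run k n coins c1 xs = (c2, o2)" by fastforce
  show ?case using Cons.prems Cons.IH[of c1 o2] length_arrive[OF assms(1) a] a r by auto
qed auto

lemma length_level_input:
  assumes "even k"
  shows "2 ^ h * length (level_input k n \<omega> xs h) \<le> length xs"
proof (induction h)
  case (Suc h)
  obtain c out where r: "run k n (\<lambda>i. \<omega> (h, i)) new_compactor (level_input k n \<omega> xs h) = (c, out)"
    by fastforce
  have "2 * length out \<le> length (level_input k n \<omega> xs h)"
    using length_run[OF assms r] by (simp add: new_compactor_def)
  then have "2 ^ h * (2 * length out) \<le> 2 ^ h * length (level_input k n \<omega> xs h)"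
    by (rule mult_le_mono2)
  also have "\<dots> \<le> length xs" by (rule Suc)
  finally show ?case using r by (simp add: ac_simps)
qed simp

lemma finite_levels:
  assumes "even k"
  shows "finite (levels k n \<omega> xs)"
proof (rule finite_subset)
  show "levels k n \<omega> xs \<subseteq> {..length xs}"
  proof
    fix h assume h: "h \<in> levels k n \<omega> xs"
    show "h \<in> {..length xs}"
    proof (cases "h = 0")
      case False
      then have "1 \<le> length (level_input k n \<omega> xs h)"
        using h by (cases "level_input k n \<omega> xs h") (auto simp: levels_def)
      then have "2 ^ h * 1 \<le> 2 ^ h * length (level_input k n \<omega> xs h)"
        by (rule mult_le_mono2)
      also have "\<dots> \<le> length xs" by (rule length_level_input[OF assms])
      finally have "2 ^ h \<le> length xs" by simp
      with less_exp[of h] have "h < length xs" by (rule less_le_trans)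
      then show ?thesis by simp
    qed simp
  qed
qed simp

end

theory Submission
  imports Defs
begin

text \<open>A compaction changes the estimate of the rank of \<open>y\<close> only if its block contains an odd
  number of items up to \<open>y\<close>, and then by \<open>2 ^ h\<close> with a fair random sign. Which compactions of a level
  are of this kind is determined by the input of the level, and there are at most
  \<open>1 / k\<close> times the rank of \<open>y\<close> in that input, by an amortisation that follows the binary
  representation of the state. There are none once that rank is at most half the capacity. The
  error, stopped as soon as it exceeds \<open>\<epsilon>\<close> times the rank \<open>r\<close> of \<open>y\<close>, is therefore a
  martingale of total variance at most \<open>16 * r\<^sup>2 / (k * B)\<close> for the capacity \<open>B\<close>, and its
  exponential moments give the tail bound \<open>2 * \<delta>\<^sup>2 < 3 * \<delta>\<close>.\<close>

subsection \<open>A single compactor\<close>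

text \<open>The obstacle is a circularity: the variance of a level is bounded through the rank of
  \<open>y\<close> in its input, but that rank is itself random and is inflated by the errors of the
  lower levels. Stopping breaks the circle without a union bound over the levels. It uses
  \<open>\<epsilon> \<le> 1\<close>: an error below \<open>\<epsilon> * r\<close> is also below
  \<open>r\<close>. The amortisation rests on the carry of a binary increment, which clears the
  trailing ones of the state and sets the next bit, so the state itself is the ledger of recent
  block sizes. The constants fit together as follows. For the capacity \<open>2 * k * m\<close>, the
  exponent in the tail bound is \<open>\<epsilon>^2 * k^2 * m / 16\<close>. Put
  \<open>D = ln (1 / \<delta>)\<close> and \<open>L = log 2 (\<epsilon> * n)\<close>. Then
  \<open>k\<close> is at least \<open>8 / \<epsilon> * sqrt (D / L)\<close> and \<open>m\<close> is
  at least \<open>L / 2\<close>, which makes the exponent at least \<open>2 * D\<close>. The bound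
  on \<open>m\<close> comes from \<open>\<delta> > 1 / exp (\<epsilon> * n / 64)\<close>, which
  keeps \<open>k\<close> at most \<open>sqrt (n / \<epsilon>)\<close>.\<close>

lemma trailing_ones_bit:
  "(\<forall>i<trailing_ones C. bit C i \<and> \<not> bit (Suc C) i) \<and>
   \<not> bit C (trailing_ones C) \<and> bit (Suc C) (trailing_ones C) \<and>
   (\<forall>i>trailing_ones C. bit (Suc C) i = bit C i) \<and> 2 ^ trailing_ones C \<le> Suc C"
proof (induction C rule: trailing_ones.induct)
  case (1 C)
  show ?case
  proof (cases "odd C")
    case True
    then have t: "trailing_ones C = Suc (trailing_ones (C div 2))"
      by (subst trailing_ones.simps) simp
    have s: "Suc C div 2 = Suc (C div 2)" "even (Suc C)" using True by auto
    note IH = 1[OF True]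
    have le: "2 * 2 ^ trailing_ones (C div 2) \<le> Suc C"
      using IH True by (auto elim!: oddE)
    have "bit C i \<and> \<not> bit (Suc C) i" if "i < trailing_ones C" for i
      using that IH True s by (cases i) (auto simp: t bit_Suc bit_0)
    moreover have "bit (Suc C) i = bit C i" if "i > trailing_ones C" for i
      using that IH True s by (cases i) (auto simp: t bit_Suc)
    ultimately show ?thesis
      using IH s le by (auto simp: t bit_Suc)
  next
    case False
    then have t: "trailing_ones C = 0"
      by (subst trailing_ones.simps) simp
    have s: "Suc C div 2 = C div 2" using False by auto
    have "bit (Suc C) i = bit C i" if "i > 0" for i
      using that s by (cases i) (auto simp: bit_Suc)
    then show ?thesis using False by (auto simp: t bit_0)
  qed
qed

text \<open>For a compactor in state \<open>C\<close> whose buffer of capacity \<open>B\<close> holds \<open>b\<close> items up to \<open>y\<close>, these are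
  the block sizes \<open>(i + 1) * k\<close> whose last compaction may still be unpaid: every compaction of a
  block containing items up to \<open>y\<close> incurs a debt of \<open>k\<close>, paid when a larger compaction removes the
  \<open>k\<close> items of the next section, all of them at most \<open>y\<close>. A set bit \<open>i\<close> of \<open>C\<close> says that no larger
  compaction has happened since.\<close>

definition pending :: "nat \<Rightarrow> nat \<Rightarrow> nat \<Rightarrow> nat \<Rightarrow> nat set" where
  "pending k B C b = {i. bit C i \<and> B \<le> b + (i + 1) * k}"

lemma bit_nat_less:
  fixes C :: nat
  assumes "C < 2 ^ m" "bit C i"
  shows "i < m"
proof (rule ccontr)
  assume "\<not> i < m"
  then have "(2::nat) ^ m \<le> 2 ^ i" by (intro power_increasing) auto
  with assms(1) have "C < 2 ^ i" by linarith
  then have "C div 2 ^ i = 0" by simp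
  then show False using assms(2) by (simp add: bit_iff_odd)
qed

lemma finite_pending: "finite (pending k B C b)"
proof -
  have "pending k B C b \<subseteq> {..<C}"
    using bit_nat_less[OF less_exp] by (auto simp: pending_def)
  then show ?thesis by (rule finite_subset) simp
qed

text \<open>For a full buffer the right-hand side counts the items up to \<open>y\<close> in the
  block of size \<open>(j + 1) * k\<close>. The least pending index \<open>i0\<close> satisfies
  \<open>B \<le> b + (i0 + 1) * k\<close>, and all counted indices lie in \<open>{i0..<j}\<close>,
  so each of them has its own section of \<open>k\<close> such items.\<close>

lemma card_pending_below:
  assumes "b \<le> B"
  shows "k * card {i \<in> pending k B C b. i < j} \<le> b + (j + 1) * k - B"
proof (cases "{i \<in> pending k B C b. i < j} = {}")
  case False
  define i0 where "i0 = (LEAST i. i \<in> pending k B C b)"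
  from False obtain i where i: "i \<in> pending k B C b" "i < j" by auto
  have i0: "i0 \<in> pending k B C b" unfolding i0_def using i(1) by (rule LeastI)
  have le: "i0 \<le> i'" if "i' \<in> pending k B C b" for i'
    unfolding i0_def using that by (rule Least_le)
  have "{i \<in> pending k B C b. i < j} \<subseteq> {i0..<j}" using le by auto
  then have "card {i \<in> pending k B C b. i < j} \<le> j - i0"
    using card_mono[of "{i0..<j}"] by simp
  then have "k * card {i \<in> pending k B C b. i < j} \<le> k * (j - i0)" by simp
  moreover have "k * (j - i0) + (i0 + 1) * k = (j + 1) * k"
    using le[OF i(1)] i(2) by (simp add: algebra_simps flip: add_mult_distrib2)
  moreover have "B \<le> b + (i0 + 1) * k" using i0 by (simp add: pending_def)
  ultimately show ?thesis by linarith
next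
  case True
  show ?thesis unfolding True by simp
qed

text \<open>At the end of the stream no larger compaction is left to pay, but the items up to
  \<open>y\<close> still in the buffer cover the debt. All set bits are below \<open>m\<close>, so
  the count below \<open>j = m\<close> is the full count.\<close>

lemma card_pending:
  assumes "b \<le> 2 * k * m" "C < 2 ^ m" "m \<ge> 1"
  shows "k * card (pending k (2 * k * m) C b) \<le> b"
proof -
  have "pending k (2 * k * m) C b = {i \<in> pending k (2 * k * m) C b. i < m}"
    using bit_nat_less[OF assms(2)] by (auto simp: pending_def)
  with card_pending_below[OF assms(1), of k C m]
  have "k * card (pending k (2 * k * m) C b) \<le> b + (m + 1) * k - 2 * k * m" by simp
  moreover have "(m + 1) * k \<le> 2 * k * m" using assms(3) by (cases m) auto
  ultimately show ?thesis by linarith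
qed

text \<open>The amortised cost of one compaction. If its block contains items up to
  \<open>y\<close>, the increment clears the bits below \<open>trailing_ones C\<close>, whose debts
  are paid by the \<open>b - b'\<close> removed items; bit \<open>trailing_ones C\<close> becomes
  the new debt, and larger pending bits survive. Otherwise \<open>b \<le> B - J * k\<close>, so a
  pending index belongs to a block at least as large as this one, and no pending bit is
  cleared.\<close>

lemma card_pending_compact:
  fixes C :: nat
  defines "J \<equiv> trailing_ones C + 1"
  assumes "k > 0" "b \<le> B" "J * k \<le> B"
  defines "b' \<equiv> min b (B - J * k)"
  shows "(if b' < b then k else 0) + k * card (pending k B C b)
          \<le> (b - b') + k * card (pending k B (Suc C) b')"
proof (cases "b' < b")
  case True
  then have b': "b' = B - J * k" by (simp add: b'_def min_def split: if_splits)
  let ?z = "trailing_ones C"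
  note bits = trailing_ones_bit[of C]
  have split: "pending k B C b = {i \<in> pending k B C b. i < ?z} \<union> {i \<in> pending k B C b. i > ?z}"
    using bits by (auto simp: pending_def) (metis nat_neq_iff)
  have "k * card {i \<in> pending k B C b. i < ?z} \<le> b - b'"
    using card_pending_below[OF assms(3), of k C ?z] b' assms(4) by (simp add: J_def)
  moreover have "insert ?z {i \<in> pending k B C b. i > ?z} \<subseteq> pending k B (Suc C) b'"
  proof
    fix i assume i: "i \<in> insert ?z {i \<in> pending k B C b. i > ?z}"
    then have "bit (Suc C) i" using bits by (auto simp: pending_def)
    moreover have "J * k \<le> (i + 1) * k" using i by (intro mult_le_mono1) (auto simp: J_def)
    ultimately show "i \<in> pending k B (Suc C) b'"
      using b' assms(4) by (simp add: pending_def)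
  qed
  then have "card (insert ?z {i \<in> pending k B C b. i > ?z}) \<le> card (pending k B (Suc C) b')"
    by (rule card_mono[OF finite_pending])
  then have "Suc (card {i \<in> pending k B C b. i > ?z}) \<le> card (pending k B (Suc C) b')"
    using finite_pending by (subst (asm) card_insert_disjoint) auto
  then have "k * Suc (card {i \<in> pending k B C b. i > ?z}) \<le> k * card (pending k B (Suc C) b')"
    by (rule mult_le_mono2)
  moreover have "card (pending k B C b)
      \<le> card {i \<in> pending k B C b. i < ?z} + card {i \<in> pending k B C b. i > ?z}"
    by (subst split) (rule card_Un_le)
  then have "k * card (pending k B C b)
      \<le> k * (card {i \<in> pending k B C b. i < ?z} + card {i \<in> pending k B C b. i > ?z})"
    by (rule mult_le_mono2)
  ultimately show ?thesis using True by (simp add: algebra_simps)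
next
  case False
  then have b': "b' = b" "b \<le> B - J * k" by (auto simp: b'_def min_def split: if_splits)
  note bits = trailing_ones_bit[of C]
  have "pending k B C b \<subseteq> pending k B (Suc C) b'"
  proof
    fix i assume i: "i \<in> pending k B C b"
    have "J \<le> i + 1"
    proof (rule ccontr)
      assume "\<not> J \<le> i + 1"
      then have "(i + 1) * k < J * k" using assms(2) by (intro mult_less_mono1) auto
      moreover have "B \<le> b + (i + 1) * k" using i by (simp add: pending_def)
      ultimately show False using b' assms(4) by linarith
    qed
    moreover have "i \<noteq> trailing_ones C" using i bits by (auto simp: pending_def)
    ultimately have "i > trailing_ones C" by (simp add: J_def)
    then show "i \<in> pending k B (Suc C) b'" using i bits b' by (simp add: pending_def)
  qed
  then have "card (pending k B C b) \<le> card (pending k B (Suc C) b')"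
    by (rule card_mono[OF finite_pending])
  then show ?thesis using b' by simp
qed


section \<open>Ranks through one compaction\<close>

lemma item_rank_simps [simp]:
  "item_rank y {#} = 0"
  "item_rank y (add_mset x X) = (if x \<le> y then Suc (item_rank y X) else item_rank y X)"
  "item_rank y (X + Y) = item_rank y X + item_rank y Y"
  by (auto simp: item_rank_def)

lemma item_rank_le_size: "item_rank y X \<le> size X"
  unfolding item_rank_def by (rule size_filter_mset_lesseq)

lemma item_rank_sorted_take_drop:
  assumes "sorted xs"
  shows "item_rank y (mset (take p xs)) = min p (item_rank y (mset xs))"
    and "item_rank y (mset (drop p xs)) = item_rank y (mset xs) - p"
proof -
  have eq: "item_rank y (mset zs) = length (takeWhile (\<lambda>x. x \<le> y) zs)" if "sorted zs" for zs :: "'a list"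
    using that
  proof (induction zs)
    case (Cons z zs)
    then show ?case
      by (cases "z \<le> y"; cases zs) (auto simp: item_rank_def filter_mset_eq_conv)
  qed simp
  have len: "length (takeWhile P (take p zs)) = min p (length (takeWhile P zs))" for P p and zs :: "'a list"
    by (induction zs arbitrary: p) (simp_all add: take_Cons split: nat.split)
  have *: "item_rank y (mset (take p xs)) = min p (item_rank y (mset xs))"
    using assms by (simp add: eq sorted_wrt_take len)
  show "item_rank y (mset (take p xs)) = min p (item_rank y (mset xs))" by (fact *)
  have "item_rank y (mset xs) = item_rank y (mset (take p xs)) + item_rank y (mset (drop p xs))"
    by (simp flip: item_rank_simps(3) mset_append)
  then show "item_rank y (mset (drop p xs)) = item_rank y (mset xs) - p"
    using * by simp
qed

definition coin_sign :: "bool \<Rightarrow> real" where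
  "coin_sign b = (if b then 1 else - 1)"

text \<open>The items up to \<open>y\<close> form a prefix of the block. Each full pair in it
  contributes one output item whatever the coin is. If its length is odd, its last item has an even
  index and is output exactly when the coin is \<open>True\<close>.\<close>

lemma item_rank_nths_parity:
  assumes "sorted xs"
  shows "2 * real (item_rank y (mset (nths xs {i. if b then even i else odd i})))
    = real (item_rank y (mset xs)) + (if odd (item_rank y (mset xs)) then coin_sign b else 0)"
  using assms
proof (induction xs rule: induct_list012)
  case (3 x z zs)
  have eq: "{j. Suc (Suc j) \<in> {i. if b then even i else odd i}} = {i. if b then even i else odd i}"
    by auto
  have nths: "nths (x # z # zs) {i. if b then even i else odd i}
      = (if b then x else z) # nths zs {i. if b then even i else odd i}"
    using eq by (cases b) (simp_all add: nths_Cons)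
  show ?case
  proof (cases "z \<le> y")
    case True
    then have "x \<le> y" using 3(3) by (auto intro: order_trans)
    with True 3 show ?thesis by (simp add: nths)
  next
    case False
    have 0: "item_rank y X = 0" if "set_mset X \<subseteq> set zs" for X
    proof -
      have "\<not> a \<le> y" if "a \<in># X" for a
      proof -
        have "z \<le> a" using 3(3) that \<open>set_mset X \<subseteq> set zs\<close> by auto
        with False show ?thesis by auto
      qed
      then show ?thesis by (simp add: item_rank_def filter_mset_eq_conv)
    qed
    have "item_rank y (mset zs) = 0"
      "item_rank y (mset (nths zs {i. if b then even i else odd i})) = 0"
      by (rule 0; auto dest: in_set_nthsD)+
    with False show ?thesis by (simp add: nths coin_sign_def)
  qed
qed (auto simp: coin_sign_def nths_singleton)

lemma compact_item_rank:
  fixes c c' :: "'a::linorder compactor" and y :: 'a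
  defines "J \<equiv> trailing_ones (state c) + 1"
  defines "b \<equiv> item_rank y (buffer c)"
  assumes "J * k \<le> size (buffer c)" "compact k coin c = (c', out)"
  defines "b' \<equiv> item_rank y (buffer c')"
  shows "b' = min b (size (buffer c) - J * k)"
    and "2 * real (item_rank y (mset out)) = real (b - b') + (if odd (b - b') then coin_sign coin else 0)"
    and "state c' = Suc (state c)"
    and "size (buffer c') = size (buffer c) - J * k"
proof -
  define s where "s = sorted_list_of_multiset (buffer c)"
  have ms: "mset s = buffer c" by (simp add: s_def)
  have len: "length s = size (buffer c)" using arg_cong[OF ms, of size] by simp
  have sorted: "sorted s" by (simp add: s_def)
  have c': "c' = \<lparr>buffer = mset (take (length s - J * k) s), state = Suc (state c)\<rparr>"
    and out: "out = nths (drop (length s - J * k) s) {i. if coin then even i else odd i}"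
    using assms(4) by (auto simp: compact_def Let_def s_def J_def)
  show b': "b' = min b (size (buffer c) - J * k)"
    using item_rank_sorted_take_drop(1)[OF sorted, of y "length s - J * k"]
    by (simp add: b'_def b_def c' ms len min.commute)
  have "item_rank y (mset (drop (length s - J * k) s)) = b - b'"
    using item_rank_sorted_take_drop(2)[OF sorted, of y "length s - J * k"] b'
    by (simp add: b_def ms len min_def)
  then show "2 * real (item_rank y (mset out)) = real (b - b') + (if odd (b - b') then coin_sign coin else 0)"
    using item_rank_nths_parity[OF sorted_wrt_drop[OF sorted], of y "length s - J * k" coin]
    by (simp only: out)
  show "state c' = Suc (state c)" "size (buffer c') = size (buffer c) - J * k"
    using assms(3) len by (simp_all add: c')
qed

text \<open>Here \<open>k * m\<close> is half the capacity. Every compaction removes at least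
  \<open>k\<close> items, so \<open>n_le\<close> keeps the state below \<open>2 ^ m\<close>, and
  this limits the number of trailing ones.\<close>

locale sketch_params =
  fixes k n m :: nat
  assumes even_k: "even k" and k_pos: "0 < k" and m_pos: "1 \<le> m"
    and capacity_eq: "capacity k n = 2 * k * m"
    and n_le: "n \<le> k * 2 ^ m"
begin

text \<open>\<open>xs\<close> is the input still to come. The last conjunct is a budget of items: at
  least \<open>k\<close> removed by each past compaction, those in the buffer, and those to
  come.\<close>

definition valid :: "'a::linorder compactor \<Rightarrow> 'a list \<Rightarrow> bool" where
  "valid c xs \<longleftrightarrow> size (buffer c) \<le> 2 * k * m \<and> state c < 2 ^ m
     \<and> k * state c + size (buffer c) + length xs \<le> n"

text \<open>A full buffer and one arriving item leave room in the budget for one more compaction, so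
  \<open>Suc (state c) < 2 ^ m\<close>. Since \<open>2 ^ trailing_ones C \<le> Suc C\<close>, there
  are fewer than \<open>m\<close> trailing ones.\<close>

lemma block_le_half:
  assumes "valid c (x # xs)" "size (buffer c) = 2 * k * m"
  shows "(trailing_ones (state c) + 1) * k \<le> k * m" "Suc (state c) < 2 ^ m"
proof -
  have "2 * k \<le> 2 * k * m" using m_pos by simp
  moreover have "k * state c + 2 * k * m + Suc (length xs) \<le> n"
    using assms unfolding valid_def by simp
  ultimately have *: "k * Suc (state c) < k * 2 ^ m"
    using n_le k_pos unfolding mult_Suc_right by linarith
  then show "Suc (state c) < 2 ^ m" by (simp only: mult_less_cancel1)
  with trailing_ones_bit[of "state c"] have "(2::nat) ^ trailing_ones (state c) < 2 ^ m" by linarith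
  then have "trailing_ones (state c) < m" by (rule power_less_imp_less_exp[rotated]) simp
  then show "(trailing_ones (state c) + 1) * k \<le> k * m"
    by (subst mult.commute) (intro mult_le_mono2, simp)
qed

lemma valid_arrive:
  assumes "valid c (x # xs)" "arrive k n coins c x = (c', out)"
  shows "valid c' xs"
proof (cases "size (buffer c) = 2 * k * m")
  case True
  obtain c1 where c1: "compact k (coins (state c)) c = (c1, out)"
    and c': "c' = c1\<lparr>buffer := add_mset x (buffer c1)\<rparr>"
    using assms(2) True by (auto simp: arrive_def capacity_eq split: prod.splits)
  note le = block_le_half[OF assms(1) True]
  then have le': "(trailing_ones (state c) + 1) * k \<le> size (buffer c)"
    using True by simp
  note cmp = compact_item_rank(3,4)[OF le' c1]
  have "k \<le> (trailing_ones (state c) + 1) * k" by simp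
  then show ?thesis
    using assms(1) le le' k_pos cmp True unfolding valid_def c'
    by (auto simp: algebra_simps)
next
  case False
  then show ?thesis
    using assms by (auto simp: arrive_def capacity_eq valid_def)
qed

lemma valid_run:
  assumes "valid c xs"
  shows "valid (fst (run k n coins c xs)) []"
  using assms
proof (induction xs arbitrary: c)
  case (Cons x xs)
  obtain c1 o1 where "arrive k n coins c x = (c1, o1)" by fastforce
  then show ?case
    using Cons.IH[OF valid_arrive[OF Cons.prems, of coins c1 o1]] by (auto split: prod.splits)
qed simp

text \<open>The set \<open>M\<close> consists of the compactions whose block contains an odd number of items up to
  \<open>y\<close>. It is chosen before the coins because a compaction's coin affects only the
  output, never the buffer.\<close>

lemma run_item_rank:
  assumes "valid c xs"
  shows "\<exists>M \<subseteq> {state c..<state c + length xs}.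
    (\<forall>coins. 2 * real (item_rank y (mset (snd (run k n coins c xs))))
             + real (item_rank y (buffer (fst (run k n coins c xs))))
           = real (item_rank y (mset xs)) + real (item_rank y (buffer c))
             + (\<Sum>i\<in>M. coin_sign (coins i))) \<and>
    k * card M + k * card (pending k (2 * k * m) (state c) (item_rank y (buffer c)))
      \<le> item_rank y (mset xs) + item_rank y (buffer c) \<and>
    (item_rank y (mset xs) + item_rank y (buffer c) \<le> k * m \<longrightarrow> M = {})"
  using assms
proof (induction xs arbitrary: c)
  case Nil
  have "item_rank y (buffer c) \<le> 2 * k * m"
    using item_rank_le_size[of y "buffer c"] Nil by (simp add: valid_def)
  then have "k * card (pending k (2 * k * m) (state c) (item_rank y (buffer c)))
      \<le> item_rank y (buffer c)"
    using Nil m_pos by (intro card_pending) (auto simp: valid_def)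
  then show ?case by (intro exI[of _ "{}"]) simp
next
  case (Cons x xs)
  let ?b = "item_rank y (buffer c)" and ?x = "if x \<le> y then 1 else 0 :: nat"
  show ?case
  proof (cases "size (buffer c) = 2 * k * m")
    case False
    define c1 where "c1 = c\<lparr>buffer := add_mset x (buffer c)\<rparr>"
    have arr: "arrive k n coins c x = (c1, [])" for coins
      using False by (simp add: arrive_def capacity_eq c1_def)
    obtain M where M: "M \<subseteq> {state c1..<state c1 + length xs}"
      "\<And>coins. 2 * real (item_rank y (mset (snd (run k n coins c1 xs))))
             + real (item_rank y (buffer (fst (run k n coins c1 xs))))
           = real (item_rank y (mset xs)) + real (item_rank y (buffer c1))
             + (\<Sum>i\<in>M. coin_sign (coins i))"
      "k * card M + k * card (pending k (2 * k * m) (state c1) (item_rank y (buffer c1)))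
        \<le> item_rank y (mset xs) + item_rank y (buffer c1)"
      "item_rank y (mset xs) + item_rank y (buffer c1) \<le> k * m \<longrightarrow> M = {}"
      using Cons.IH[OF valid_arrive[OF Cons.prems arr]] by blast
    have "pending k (2 * k * m) (state c) ?b \<subseteq> pending k (2 * k * m) (state c1) (item_rank y (buffer c1))"
      by (auto simp: pending_def c1_def)
    then have "k * card (pending k (2 * k * m) (state c) ?b)
        \<le> k * card (pending k (2 * k * m) (state c1) (item_rank y (buffer c1)))"
      by (intro mult_le_mono2 card_mono finite_pending)
    moreover have rank: "item_rank y (mset xs) + item_rank y (buffer c1) = item_rank y (mset (x # xs)) + ?b"
      by (simp add: c1_def)
    ultimately have "k * card M + k * card (pending k (2 * k * m) (state c) ?b)
        \<le> item_rank y (mset (x # xs)) + ?b"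
      using M(3) by linarith
    moreover have "2 * real (item_rank y (mset (snd (run k n coins c (x # xs)))))
             + real (item_rank y (buffer (fst (run k n coins c (x # xs)))))
           = real (item_rank y (mset (x # xs))) + real ?b + (\<Sum>i\<in>M. coin_sign (coins i))" for coins
      using M(2)[of coins] arg_cong[OF rank, of real] by (simp add: arr split: prod.splits)
    moreover have "M \<subseteq> {state c..<state c + length (x # xs)}"
      using M(1) by (auto simp: c1_def)
    ultimately show ?thesis using M(4) unfolding rank by blast
  next
    case True
    let ?J = "trailing_ones (state c) + 1"
    note half = block_le_half[OF Cons.prems True]
    then have le: "?J * k \<le> size (buffer c)" using True by simp
    \<comment> \<open>Fixing the remaining compactor before any coin is chosen lets the induction
      hypothesis provide one \<open>M\<close> for all coins.\<close>
    obtain c0 where c0: "\<And>coin. fst (compact k coin c) = c0"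
      by (auto simp: compact_def Let_def)
    define o0 where "o0 coin = snd (compact k coin c)" for coin
    have cmp: "compact k coin c = (c0, o0 coin)" for coin
      using c0[of coin] by (simp add: o0_def prod_eq_iff)
    define c1 where "c1 = c0\<lparr>buffer := add_mset x (buffer c0)\<rparr>"
    have arr: "arrive k n coins c x = (c1, o0 (coins (state c)))" for coins
      using True by (simp add: arrive_def capacity_eq c1_def cmp)
    note cir = compact_item_rank(1,2)[OF le cmp, of y] compact_item_rank(3)[OF le cmp]
    let ?b' = "item_rank y (buffer c0)"
    have st: "state c1 = Suc (state c)" by (simp add: c1_def cir(3))
    obtain M where M: "M \<subseteq> {state c1..<state c1 + length xs}"
      "\<And>coins. 2 * real (item_rank y (mset (snd (run k n coins c1 xs))))
             + real (item_rank y (buffer (fst (run k n coins c1 xs))))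
           = real (item_rank y (mset xs)) + real (item_rank y (buffer c1))
             + (\<Sum>i\<in>M. coin_sign (coins i))"
      "k * card M + k * card (pending k (2 * k * m) (state c1) (item_rank y (buffer c1)))
        \<le> item_rank y (mset xs) + item_rank y (buffer c1)"
      "item_rank y (mset xs) + item_rank y (buffer c1) \<le> k * m \<longrightarrow> M = {}"
      using Cons.IH[OF valid_arrive[OF Cons.prems arr]] by blast
    have b0: "?b' = min ?b (2 * k * m - ?J * k)" using cir(1) True by simp
    \<comment> \<open>A debt arises whenever the block contains items up to \<open>y\<close>, an
      error only if their number is odd; so \<open>card M'\<close> is at most the number of
      debts.\<close>
    define M' where "M' = (if odd (?b - ?b') then insert (state c) M else M)"
    have fin: "finite M" using M(1) by (rule finite_subset) simp
    have nin: "state c \<notin> M" using M(1) st by auto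
    have card_M': "card M' \<le> card M + (if ?b' < ?b then 1 else 0)"
      using fin nin by (auto simp: M'_def dest: odd_pos)
    have "?b \<le> 2 * k * m" using item_rank_le_size[of y "buffer c"] True by simp
    then have "(if ?b' < ?b then k else 0) + k * card (pending k (2 * k * m) (state c) ?b)
        \<le> (?b - ?b') + k * card (pending k (2 * k * m) (Suc (state c)) ?b')"
      using card_pending_compact[OF k_pos, of ?b "2 * k * m" "state c"] le True
      unfolding b0 by simp
    moreover have "pending k (2 * k * m) (Suc (state c)) ?b'
        \<subseteq> pending k (2 * k * m) (state c1) (item_rank y (buffer c1))"
      unfolding st by (auto simp: pending_def c1_def)
    then have "k * card (pending k (2 * k * m) (Suc (state c)) ?b')
        \<le> k * card (pending k (2 * k * m) (state c1) (item_rank y (buffer c1)))"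
      by (intro mult_le_mono2 card_mono finite_pending)
    moreover have "k * card M' \<le> k * card M + (if ?b' < ?b then k else 0)"
      using mult_le_mono2[OF card_M', of k] by (auto simp: algebra_simps split: if_splits)
    moreover have b1: "item_rank y (buffer c1) = ?b' + ?x" by (simp add: c1_def)
    moreover have b_le: "?b' \<le> ?b" using b0 by simp
    moreover have "item_rank y (mset (x # xs)) = ?x + item_rank y (mset xs)" by simp
    ultimately have "k * card M' + k * card (pending k (2 * k * m) (state c) ?b)
        \<le> item_rank y (mset (x # xs)) + ?b"
      using M(3) by linarith
    moreover have "M' \<subseteq> {state c..<state c + length (x # xs)}"
      using M(1) by (auto simp: M'_def st)
    \<comment> \<open>The block is at most half of the full buffer and at most half of the buffer is
      up to \<open>y\<close>, so the block contains no such item.\<close>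
    moreover have "M' = {}" if "item_rank y (mset (x # xs)) + ?b \<le> k * m"
    proof -
      have "?b \<le> 2 * k * m - ?J * k" using that half(1) by simp
      then have "?b' = ?b" using b0 by simp
      then show ?thesis using that M(4) b1 by (simp add: M'_def split: if_splits)
    qed
    moreover have "2 * real (item_rank y (mset (snd (run k n coins c (x # xs)))))
             + real (item_rank y (buffer (fst (run k n coins c (x # xs)))))
           = real (item_rank y (mset (x # xs))) + real ?b + (\<Sum>i\<in>M'. coin_sign (coins i))" for coins
    proof -
      have "(\<Sum>i\<in>M'. coin_sign (coins i))
          = (if odd (?b - ?b') then coin_sign (coins (state c)) else 0) + (\<Sum>i\<in>M. coin_sign (coins i))"
        using fin nin by (simp add: M'_def)
      moreover obtain c2 o2 where "run k n coins c1 xs = (c2, o2)" by fastforce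
      ultimately show ?thesis
        using M(2)[of coins] cir(2)[of "coins (state c)"] b1 b_le
        by (simp add: arr of_nat_diff)
    qed
    ultimately show ?thesis by blast
  qed
qed

end

subsection \<open>Sums of fair coins\<close>

text \<open>Hoeffding's lemma for a fair sign: the auxiliary inequality at width
  \<open>2 * c\<close> and probability \<open>1 / 2\<close> bounds \<open>ln (cosh c)\<close> for
  \<open>c \<ge> 0\<close>, and \<open>cosh\<close> is even.\<close>

lemma cosh_le_exp: "cosh c \<le> exp (c\<^sup>2 / 2)" for c :: real
proof -
  have *: "cosh c \<le> exp (c\<^sup>2 / 2)" if "c \<ge> 0" for c :: real
  proof -
    have "ln ((1 + exp (2 * c)) / 2) \<le> c + c\<^sup>2 / 2"
      using Hoeffdings_lemma_aux[of "2 * c" "1 / 2"] that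
      by (simp add: power2_eq_square field_simps)
    then have "exp (ln ((1 + exp (2 * c)) / 2)) \<le> exp (c + c\<^sup>2 / 2)" by simp
    moreover have "0 < (1 + exp (2 * c)) / 2" by (simp add: add_pos_pos)
    ultimately have "(1 + exp (2 * c)) / 2 \<le> exp (c + c\<^sup>2 / 2)" by (simp only: exp_ln)
    then have "(1 + exp (2 * c)) / 2 * exp (- c) \<le> exp (c + c\<^sup>2 / 2) * exp (- c)"
      by (intro mult_right_mono) auto
    also have "(1 + exp (2 * c)) / 2 * exp (- c) = cosh c"
      by (simp add: cosh_field_def field_simps flip: exp_add)
    finally show ?thesis by (simp flip: exp_add)
  qed
  show ?thesis using *[of c] *[of "- c"] by (cases "c \<ge> 0") auto
qed

lemma nn_integral_coin_sign:
  "(\<integral>\<^sup>+ b. ennreal (exp (c * coin_sign b)) \<partial>bernoulli_pmf (1/2)) = ennreal (cosh c)"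
proof -
  have "(\<integral>\<^sup>+ b. ennreal (exp (c * coin_sign b)) \<partial>bernoulli_pmf (1/2))
      = ennreal (exp c) * ennreal (1/2) + ennreal (exp (- c)) * ennreal (1 - 1/2)"
    by (subst nn_integral_bernoulli_pmf) (simp_all add: coin_sign_def)
  also have "\<dots> = ennreal (exp c * (1/2)) + ennreal (exp (- c) * (1 - 1/2))"
    by (simp only: ennreal_mult'[OF exp_ge_zero])
  also have "\<dots> = ennreal (exp c * (1/2) + exp (- c) * (1 - 1/2))"
    by (rule ennreal_plus[symmetric]) auto
  also have "exp c * (1/2) + exp (- c) * (1 - 1/2) = cosh c"
    by (simp add: cosh_field_def field_simps)
  finally show ?thesis .
qed

text \<open>By independence the exponential moment is a power of \<open>cosh c\<close>. The
  injection \<open>e\<close> places the compactions of one level among the coordinates of the whole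
  sketch.\<close>

lemma nn_integral_coin_sum_le:
  assumes "finite J" "inj_on e M" "e ` M \<subseteq> J" "finite M"
  shows "(\<integral>\<^sup>+ \<omega>. ennreal (exp (c * (\<Sum>i\<in>M. coin_sign (\<omega> (e i))))) \<partial>Pi_pmf J d (\<lambda>_. bernoulli_pmf (1/2)))
    \<le> ennreal (exp (c\<^sup>2 * real (card M) / 2))"
proof -
  let ?P = "Pi_pmf J d (\<lambda>_. bernoulli_pmf (1/2))"
  \<comment> \<open>Padding with factors \<open>1\<close> extends the product over all of
    \<open>J\<close>, the index set of the product measure.\<close>
  define f where "f p b = (if p \<in> e ` M then exp (c * coin_sign b) else 1)" for p b
  have "exp (c * (\<Sum>i\<in>M. coin_sign (\<omega> (e i)))) = (\<Prod>p\<in>J. f p (\<omega> p))" for \<omega>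
  proof -
    have "exp (c * (\<Sum>i\<in>M. coin_sign (\<omega> (e i)))) = (\<Prod>i\<in>M. exp (c * coin_sign (\<omega> (e i))))"
      by (simp add: sum_distrib_left exp_sum assms)
    also have "\<dots> = (\<Prod>p\<in>e ` M. exp (c * coin_sign (\<omega> p)))"
      by (simp add: prod.reindex assms)
    also have "\<dots> = (\<Prod>p\<in>J. f p (\<omega> p))"
      unfolding f_def using assms by (intro prod.mono_neutral_cong_left) auto
    finally show ?thesis .
  qed
  then have "(\<integral>\<^sup>+ \<omega>. ennreal (exp (c * (\<Sum>i\<in>M. coin_sign (\<omega> (e i))))) \<partial>?P)
      = (\<integral>\<^sup>+ \<omega>. (\<Prod>p\<in>J. ennreal (f p (\<omega> p))) \<partial>?P)"
    by (simp add: prod_ennreal f_def)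
  also have "\<dots> = (\<Prod>p\<in>J. \<integral>\<^sup>+ b. ennreal (f p b) \<partial>bernoulli_pmf (1/2))"
    by (rule nn_integral_prod_Pi_pmf[OF assms(1)])
  also have "\<dots> = (\<Prod>p\<in>J. if p \<in> e ` M then ennreal (cosh c) else 1)"
    by (intro prod.cong refl) (simp add: f_def nn_integral_coin_sign del: nn_integral_bernoulli_pmf)
  also have "\<dots> = (\<Prod>p\<in>e ` M. ennreal (cosh c))"
    using assms by (intro prod.mono_neutral_cong_right) auto
  also have "\<dots> = ennreal (cosh c) ^ card M"
    using assms by (simp add: card_image)
  also have "\<dots> \<le> ennreal (exp (c\<^sup>2 / 2)) ^ card M"
    by (intro power_mono ennreal_leI cosh_le_exp) auto
  also have "\<dots> = ennreal (exp (c\<^sup>2 * real (card M) / 2))"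
    by (simp add: ennreal_power mult.commute flip: exp_of_nat_mult)
  finally show ?thesis .
qed

text \<open>One step of the exponential supermartingale, with conditioning expressed by splitting
  the product into \<open>J\<close> and \<open>I - J\<close>. By \<open>old\<close>, both the past
  factor \<open>G\<close> and the random set \<open>M\<close> are constant while the coins in
  \<open>J\<close> are integrated out, so the bound for a fixed set applies inside.\<close>

lemma nn_integral_fresh_coins_le:
  fixes e :: "nat \<Rightarrow> 'i" and G :: "('i \<Rightarrow> bool) \<Rightarrow> ennreal" and M :: "('i \<Rightarrow> bool) \<Rightarrow> nat set"
  defines "P I \<equiv> measure_pmf (Pi_pmf I False (\<lambda>_. bernoulli_pmf (1/2)))"
  assumes "finite I" "J \<subseteq> I" "inj e"
    and M: "\<And>\<omega>. finite (M \<omega>)" "\<And>\<omega>. e ` M \<omega> \<subseteq> J" "\<And>\<omega>. c\<^sup>2 * real (card (M \<omega>)) \<le> v"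
    and old: "\<And>\<omega> \<omega>'. (\<And>p. p \<notin> J \<Longrightarrow> \<omega> p = \<omega>' p) \<Longrightarrow> G \<omega> = G \<omega>' \<and> M \<omega> = M \<omega>'"
  shows "(\<integral>\<^sup>+ \<omega>. G \<omega> * ennreal (exp (c * (\<Sum>i\<in>M \<omega>. coin_sign (\<omega> (e i))))) \<partial>P I)
    \<le> (\<integral>\<^sup>+ \<omega>. G \<omega> \<partial>P I) * ennreal (exp (v / 2))"
proof -
  have fin: "finite J" "finite (I - J)" using assms(2,3) finite_subset by auto
  have split: "Pi_pmf I False (\<lambda>_. bernoulli_pmf (1/2)) =
      map_pmf (\<lambda>(f, g) x. if x \<in> J then f x else g x)
        (pair_pmf (Pi_pmf J False (\<lambda>_. bernoulli_pmf (1/2))) (Pi_pmf (I - J) False (\<lambda>_. bernoulli_pmf (1/2))))"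
    using Pi_pmf_union[OF fin, of False "\<lambda>_. bernoulli_pmf (1/2)"] assms(3) by (simp add: Un_absorb1)
  have eq: "(\<integral>\<^sup>+ \<omega>. F \<omega> \<partial>P I) = (\<integral>\<^sup>+ g. \<integral>\<^sup>+ f. F (\<lambda>x. if x \<in> J then f x else g x) \<partial>P J \<partial>P (I - J))" for F
    unfolding P_def split
    by (subst pair_commute_pmf) (simp add: nn_integral_pair_pmf' case_prod_unfold)
  have old': "G (\<lambda>x. if x \<in> J then f x else g x) = G g" "M (\<lambda>x. if x \<in> J then f x else g x) = M g" for f g
    using old[of "\<lambda>x. if x \<in> J then f x else g x" g] by auto
  have eJ: "e i \<in> J" if "i \<in> M \<omega>" for i \<omega> using M(2) that by auto
  have "(\<integral>\<^sup>+ \<omega>. G \<omega> * ennreal (exp (c * (\<Sum>i\<in>M \<omega>. coin_sign (\<omega> (e i))))) \<partial>P I)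
      = (\<integral>\<^sup>+ g. G g * (\<integral>\<^sup>+ f. ennreal (exp (c * (\<Sum>i\<in>M g. coin_sign (f (e i))))) \<partial>P J) \<partial>P (I - J))"
    unfolding eq old' by (simp add: eJ P_def nn_integral_cmult)
  also have "\<dots> \<le> (\<integral>\<^sup>+ g. G g * ennreal (exp (v / 2)) \<partial>P (I - J))"
  proof (intro nn_integral_mono mult_left_mono)
    fix g
    have "(\<integral>\<^sup>+ f. ennreal (exp (c * (\<Sum>i\<in>M g. coin_sign (f (e i))))) \<partial>P J)
        \<le> ennreal (exp (c\<^sup>2 * real (card (M g)) / 2))"
      unfolding P_def using assms(4) M
      by (intro nn_integral_coin_sum_le fin) (auto intro: inj_on_subset)
    also have "\<dots> \<le> ennreal (exp (v / 2))" using M(3)[of g] by (intro ennreal_leI) simp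
    finally show "(\<integral>\<^sup>+ f. ennreal (exp (c * (\<Sum>i\<in>M g. coin_sign (f (e i))))) \<partial>P J)
        \<le> ennreal (exp (v / 2))" .
  qed simp
  also have "\<dots> = (\<integral>\<^sup>+ \<omega>. G \<omega> \<partial>P I) * ennreal (exp (v / 2))"
    unfolding eq old' by (simp add: P_def nn_integral_multc measure_pmf.emeasure_space_1)
  finally show ?thesis .
qed

text \<open>Transfers the question from the infinite product to a finite one, where integrals can be
  split by coordinates: an event that depends only on the coins in \<open>I\<close> is a finite
  disjoint union of cylinders.\<close>

lemma coin_flips_finite_dependence:
  assumes "finite I" and dep: "\<And>\<omega> \<omega>'. (\<And>p. p \<in> I \<Longrightarrow> \<omega> p = \<omega>' p) \<Longrightarrow> Q \<omega> = Q \<omega>'"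
  shows "{\<omega> \<in> space coin_flips. Q \<omega>} \<in> sets coin_flips"
    and "measure coin_flips {\<omega> \<in> space coin_flips. Q \<omega>}
      = measure_pmf.prob (Pi_pmf I False (\<lambda>_. bernoulli_pmf (1/2))) {\<omega>. Q \<omega>}"
proof -
  let ?M = "\<lambda>_ :: nat \<times> nat. measure_pmf (bernoulli_pmf (1/2))"
  let ?D = "PiE_dflt I False (\<lambda>_. UNIV :: bool set)"
  let ?P = "Pi_pmf I False (\<lambda>_. bernoulli_pmf (1/2))"
  interpret product_prob_space ?M UNIV by unfold_locales
  define cyl where "cyl f = prod_emb UNIV ?M I (PiE I (\<lambda>p. {f p}))" for f
  have cyl_iff: "\<omega> \<in> cyl f \<longleftrightarrow> (\<forall>p\<in>I. \<omega> p = f p)" for \<omega> f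
    by (auto simp: cyl_def prod_emb_def space_PiM PiE_iff extensional_def)
  have cyl_sets: "cyl f \<in> sets coin_flips" for f
    unfolding coin_flips_def cyl_def using assms(1) by (intro sets_PiM_I) auto
  have cyl_measure: "measure coin_flips (cyl f) = (\<Prod>p\<in>I. pmf (bernoulli_pmf (1/2)) (f p))" for f
    unfolding coin_flips_def cyl_def using assms(1)
    by (subst measure_PiM_emb) (auto simp: measure_pmf_single)
  have space: "space coin_flips = UNIV" by (simp add: coin_flips_def space_PiM)
  have fin: "finite {f \<in> ?D. Q f}" using assms(1) by (intro finite_subset[OF _ finite_PiE_dflt]) auto
  have eq: "{\<omega> \<in> space coin_flips. Q \<omega>} = (\<Union>f\<in>{f \<in> ?D. Q f}. cyl f)"
  proof (intro equalityI subsetI)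
    fix \<omega> assume "\<omega> \<in> {\<omega> \<in> space coin_flips. Q \<omega>}"
    \<comment> \<open>The representative of the cylinder of \<open>\<omega>\<close>: equal to it on
      \<open>I\<close>, and the default \<open>False\<close> elsewhere.\<close>
    moreover define f where "f p = (p \<in> I \<and> \<omega> p)" for p
    ultimately have "f \<in> {f \<in> ?D. Q f}" "\<omega> \<in> cyl f"
      using dep[of \<omega> f] by (auto simp: PiE_dflt_def cyl_iff)
    then show "\<omega> \<in> (\<Union>f\<in>{f \<in> ?D. Q f}. cyl f)" by blast
  next
    fix \<omega> assume "\<omega> \<in> (\<Union>f\<in>{f \<in> ?D. Q f}. cyl f)"
    then obtain f where "Q f" "\<forall>p\<in>I. \<omega> p = f p" by (auto simp: cyl_iff)
    then show "\<omega> \<in> {\<omega> \<in> space coin_flips. Q \<omega>}"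
      using dep[of \<omega> f] by (simp add: space)
  qed
  show "{\<omega> \<in> space coin_flips. Q \<omega>} \<in> sets coin_flips"
    unfolding eq using fin cyl_sets by (intro sets.finite_UN) auto
  have "disjoint_family_on cyl {f \<in> ?D. Q f}"
  proof (unfold disjoint_family_on_def, intro ballI impI)
    fix f g assume f: "f \<in> {f \<in> ?D. Q f}" and g: "g \<in> {f \<in> ?D. Q f}" and "f \<noteq> g"
    then obtain p where "f p \<noteq> g p" by (auto simp: fun_eq_iff)
    moreover from this have "p \<in> I" using f g by (cases p) (auto simp: PiE_dflt_def)
    ultimately show "cyl f \<inter> cyl g = {}" by (auto simp: cyl_iff)
  qed
  then have "measure coin_flips {\<omega> \<in> space coin_flips. Q \<omega>} = (\<Sum>f\<in>{f \<in> ?D. Q f}. measure coin_flips (cyl f))"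
    unfolding eq using fin cyl_sets
    by (intro P.finite_measure_finite_Union[folded coin_flips_def]) auto
  also have "\<dots> = (\<Sum>f\<in>{f \<in> ?D. Q f}. pmf ?P f)"
    unfolding cyl_measure using assms(1)
    by (intro sum.cong refl) (auto simp: pmf_Pi PiE_dflt_def)
  also have "\<dots> = measure_pmf.prob ?P {f \<in> ?D. Q f}"
    by (rule measure_measure_pmf_finite[symmetric, OF fin])
  also have "\<dots> = measure_pmf.prob ?P {\<omega>. Q \<omega>}"
    using set_Pi_pmf_subset[OF assms(1), of False "\<lambda>_. bernoulli_pmf (1/2)"]
    by (intro measure_pmf.finite_measure_eq_AE AE_pmfI) (auto simp: PiE_dflt_def)
  finally show "measure coin_flips {\<omega> \<in> space coin_flips. Q \<omega>}
      = measure_pmf.prob ?P {\<omega>. Q \<omega>}" .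
qed

subsection \<open>The error of the sketch\<close>

lemma run_cong:
  assumes "\<And>i. i < state c + length xs \<Longrightarrow> coins i = coins' i"
  shows "run k n coins c xs = run k n coins' c xs"
  using assms
proof (induction xs arbitrary: c)
  case (Cons x xs)
  have eq: "arrive k n coins c x = arrive k n coins' c x"
    using Cons.prems[of "state c"] by (simp add: arrive_def)
  obtain c1 o1 where c1: "arrive k n coins' c x = (c1, o1)" by fastforce
  then have "state c1 \<le> Suc (state c)"
    by (auto simp: arrive_def compact_def Let_def split: if_splits)
  then have "run k n coins c1 xs = run k n coins' c1 xs"
    by (intro Cons.IH Cons.prems) auto
  then show ?case by (simp add: eq c1)
qed simp

lemma length_level_input_le:
  assumes "even k"
  shows "length (level_input k n \<omega> xs h) \<le> length xs"
proof -
  have "1 * length (level_input k n \<omega> xs h) \<le> 2 ^ h * length (level_input k n \<omega> xs h)"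
    by (intro mult_le_mono1) simp
  also have "\<dots> \<le> length xs" by (rule length_level_input[OF assms])
  finally show ?thesis by simp
qed

lemma level_input_eq_Nil:
  assumes "even k" "length xs < h"
  shows "level_input k n \<omega> xs h = []"
proof (rule ccontr)
  assume "level_input k n \<omega> xs h \<noteq> []"
  then have "2 ^ h * 1 \<le> 2 ^ h * length (level_input k n \<omega> xs h)"
    by (intro mult_le_mono2) (simp add: Suc_le_eq)
  also have "\<dots> \<le> length xs" by (rule length_level_input[OF assms(1)])
  finally show False using less_exp[of h] assms(2) by simp
qed

lemma level_input_cong:
  assumes "even k" "\<And>i j. i < h \<Longrightarrow> j < length xs \<Longrightarrow> \<omega> (i, j) = \<omega>' (i, j)"
  shows "level_input k n \<omega> xs h = level_input k n \<omega>' xs h"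
  using assms(2)
proof (induction h)
  case (Suc h)
  then have IH: "level_input k n \<omega> xs h = level_input k n \<omega>' xs h" by simp
  have "run k n (\<lambda>i. \<omega> (h, i)) new_compactor (level_input k n \<omega>' xs h)
      = run k n (\<lambda>i. \<omega>' (h, i)) new_compactor (level_input k n \<omega>' xs h)"
    using length_level_input_le[OF assms(1), of n \<omega>' xs h]
    by (intro run_cong Suc.prems) (auto simp: new_compactor_def)
  with IH show ?case by simp
qed simp

lemma level_cong:
  assumes "even k" "\<And>i j. i \<le> h \<Longrightarrow> j < length xs \<Longrightarrow> \<omega> (i, j) = \<omega>' (i, j)"
  shows "level k n \<omega> xs h = level k n \<omega>' xs h"
proof -
  have "level_input k n \<omega> xs h = level_input k n \<omega>' xs h"
    using assms by (intro level_input_cong) auto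
  moreover have "run k n (\<lambda>i. \<omega> (h, i)) new_compactor (level_input k n \<omega>' xs h)
      = run k n (\<lambda>i. \<omega>' (h, i)) new_compactor (level_input k n \<omega>' xs h)"
    using length_level_input_le[OF assms(1), of n \<omega>' xs h]
    by (intro run_cong assms(2)) (auto simp: new_compactor_def)
  ultimately show ?thesis by (simp add: level_def)
qed

text \<open>Replaces an index set that depends on the coins by a fixed range; a level without input
  has an empty buffer and contributes nothing.\<close>

lemma estimate_eq_sum:
  assumes "even k"
  shows "estimate k n \<omega> xs y = (\<Sum>h\<le>length xs. 2 ^ h * item_rank y (buffer (level k n \<omega> xs h)))"
  unfolding estimate_def
proof (intro sum.mono_neutral_left ballI)
  show "levels k n \<omega> xs \<subseteq> {..length xs}"
  proof
    fix h assume "h \<in> levels k n \<omega> xs"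
    then show "h \<in> {..length xs}"
      using level_input_eq_Nil[OF assms, of xs h n \<omega>] by (cases "length xs < h") (auto simp: levels_def)
  qed
  fix h assume "h \<in> {..length xs} - levels k n \<omega> xs"
  then show "2 ^ h * item_rank y (buffer (level k n \<omega> xs h)) = 0"
    by (simp add: levels_def level_def new_compactor_def)
qed simp

lemma Err_cong:
  assumes "even k" "\<And>p. p \<in> {..length xs} \<times> {..<length xs} \<Longrightarrow> \<omega> p = \<omega>' p"
  shows "Err k n \<omega> xs y = Err k n \<omega>' xs y"
proof -
  have "level k n \<omega> xs h = level k n \<omega>' xs h" if "h \<le> length xs" for h
    using assms that by (intro level_cong) auto
  then show ?thesis by (simp add: Err_def estimate_eq_sum[OF assms(1)])
qed

section \<open>Decomposition of the error over the levels\<close>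

context sketch_params
begin

text \<open>The choice makes the set a function of the input list alone. The set of a level is
  thereby fixed by the coins of lower levels and independent of the coins it selects.\<close>

definition odd_compactions :: "'a::linorder \<Rightarrow> 'a list \<Rightarrow> nat set" where
  "odd_compactions y xs = (SOME M. M \<subseteq> {..<length xs} \<and>
    (\<forall>coins. 2 * real (item_rank y (mset (snd (run k n coins new_compactor xs))))
             + real (item_rank y (buffer (fst (run k n coins new_compactor xs))))
           = real (item_rank y (mset xs)) + (\<Sum>i\<in>M. coin_sign (coins i))) \<and>
    k * card M \<le> item_rank y (mset xs) \<and>
    (item_rank y (mset xs) \<le> k * m \<longrightarrow> M = {}))"

lemma odd_compactions:
  assumes "length xs \<le> n"
  shows "odd_compactions y xs \<subseteq> {..<length xs}"
    and "2 * real (item_rank y (mset (snd (run k n coins new_compactor xs))))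
             + real (item_rank y (buffer (fst (run k n coins new_compactor xs))))
           = real (item_rank y (mset xs)) + (\<Sum>i\<in>odd_compactions y xs. coin_sign (coins i))"
    and "k * card (odd_compactions y xs) \<le> item_rank y (mset xs)"
    and "item_rank y (mset xs) \<le> k * m \<Longrightarrow> odd_compactions y xs = {}"
proof -
  have "valid new_compactor xs" using assms by (simp add: valid_def new_compactor_def)
  from run_item_rank[OF this, of y]
  have "\<exists>M. M \<subseteq> {..<length xs} \<and>
    (\<forall>coins. 2 * real (item_rank y (mset (snd (run k n coins new_compactor xs))))
             + real (item_rank y (buffer (fst (run k n coins new_compactor xs))))
           = real (item_rank y (mset xs)) + (\<Sum>i\<in>M. coin_sign (coins i))) \<and>
    k * card M \<le> item_rank y (mset xs) \<and>
    (item_rank y (mset xs) \<le> k * m \<longrightarrow> M = {})"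
    by (simp add: new_compactor_def pending_def lessThan_atLeast0)
  from someI_ex[OF this, folded odd_compactions_def]
  show "odd_compactions y xs \<subseteq> {..<length xs}"
    and "2 * real (item_rank y (mset (snd (run k n coins new_compactor xs))))
             + real (item_rank y (buffer (fst (run k n coins new_compactor xs))))
           = real (item_rank y (mset xs)) + (\<Sum>i\<in>odd_compactions y xs. coin_sign (coins i))"
    and "k * card (odd_compactions y xs) \<le> item_rank y (mset xs)"
    and "item_rank y (mset xs) \<le> k * m \<Longrightarrow> odd_compactions y xs = {}"
    by blast+
qed

definition level_error :: "'a::linorder list \<Rightarrow> 'a \<Rightarrow> (nat \<times> nat \<Rightarrow> bool) \<Rightarrow> nat \<Rightarrow> real" where
  "level_error xs y \<omega> h =
     2 ^ h * (\<Sum>i\<in>odd_compactions y (level_input k n \<omega> xs h). coin_sign (\<omega> (h, i)))"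

lemma level_input_length_le_n:
  "length xs \<le> n \<Longrightarrow> length (level_input k n \<omega> xs h) \<le> n"
  using length_level_input_le[OF even_k, of n \<omega> xs h] by simp

lemma item_rank_level_input_Suc:
  assumes "length xs \<le> n"
  shows "2 ^ Suc h * real (item_rank y (mset (level_input k n \<omega> xs (Suc h))))
       + 2 ^ h * real (item_rank y (buffer (level k n \<omega> xs h)))
     = 2 ^ h * real (item_rank y (mset (level_input k n \<omega> xs h))) + level_error xs y \<omega> h"
  using odd_compactions(2)[OF level_input_length_le_n[OF assms, of \<omega> h], of y "\<lambda>i. \<omega> (h, i)", THEN arg_cong[of _ _ "(*) (2 ^ h)"]]
  by (simp add: level_def level_error_def algebra_simps)

text \<open>The rank balances of the levels, weighted by \<open>2 ^ h\<close>, telescope. The sum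
  ends after level \<open>length xs\<close>, because the input of the next level is empty.\<close>

lemma Err_eq_sum_level_error:
  assumes "length xs \<le> n"
  shows "Err k n \<omega> xs y = (\<Sum>h<Suc (length xs). level_error xs y \<omega> h)"
proof -
  have "(\<Sum>h<l. 2 ^ h * real (item_rank y (buffer (level k n \<omega> xs h))))
      = (\<Sum>h<l. level_error xs y \<omega> h) + real (item_rank y (mset xs))
        - 2 ^ l * real (item_rank y (mset (level_input k n \<omega> xs l)))" for l
  proof (induction l)
    case (Suc l)
    then show ?case using item_rank_level_input_Suc[OF assms, of l y \<omega>] by simp
  qed simp
  from this[of "Suc (length xs)"] show ?thesis
    using level_input_eq_Nil[OF even_k, of xs "Suc (length xs)" n \<omega>]
    by (simp add: Err_def estimate_eq_sum[OF even_k] lessThan_Suc_atMost del: level_input.simps)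
qed

text \<open>The same telescoping with the nonnegative contributions of the buffers dropped. It shows
  how errors of lower levels inflate the input of level \<open>h\<close>.\<close>

lemma item_rank_level_input_le:
  assumes "length xs \<le> n"
  shows "2 ^ h * real (item_rank y (mset (level_input k n \<omega> xs h)))
    \<le> real (item_rank y (mset xs)) + (\<Sum>i<h. level_error xs y \<omega> i)"
proof (induction h)
  case (Suc h)
  have "0 \<le> 2 ^ h * real (item_rank y (buffer (level k n \<omega> xs h)))" by simp
  then show ?case
    using Suc item_rank_level_input_Suc[OF assms, of h y \<omega>] unfolding sum.lessThan_Suc by linarith
qed simp

text \<open>Stopping at the first level where the error reaches \<open>a\<close> loses nothing, because a stopped error
  counts as large. Before that, the error at most doubles the rank of \<open>y\<close> in the input of a level,
  scaled by its weight, which makes the variance of every level bounded with certainty.\<close>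

primrec stopped_error :: "real \<Rightarrow> 'a::linorder list \<Rightarrow> 'a \<Rightarrow> (nat \<times> nat \<Rightarrow> bool) \<Rightarrow> nat \<Rightarrow> real" where
  "stopped_error a xs y \<omega> 0 = 0"
| "stopped_error a xs y \<omega> (Suc h) =
     (if \<bar>stopped_error a xs y \<omega> h\<bar> < a then stopped_error a xs y \<omega> h + level_error xs y \<omega> h
      else stopped_error a xs y \<omega> h)"

lemma stopped_error_cases:
  "stopped_error a xs y \<omega> h = (\<Sum>i<h. level_error xs y \<omega> i) \<or> a \<le> \<bar>stopped_error a xs y \<omega> h\<bar>"
  by (induction h) auto

lemma level_error_cong:
  assumes "\<And>i j. i \<le> h \<Longrightarrow> \<omega> (i, j) = \<omega>' (i, j)"
  shows "level_error xs y \<omega> h = level_error xs y \<omega>' h"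
proof -
  have "level_input k n \<omega> xs h = level_input k n \<omega>' xs h"
    using assms even_k by (intro level_input_cong) auto
  then show ?thesis using assms by (simp add: level_error_def)
qed

lemma stopped_error_cong:
  assumes "\<And>i j. i < h \<Longrightarrow> \<omega> (i, j) = \<omega>' (i, j)"
  shows "stopped_error a xs y \<omega> h = stopped_error a xs y \<omega>' h"
  using assms
proof (induction h)
  case (Suc h)
  moreover have "level_error xs y \<omega> h = level_error xs y \<omega>' h"
    using Suc.prems by (intro level_error_cong) auto
  ultimately show ?case by simp
qed simp

text \<open>Let \<open>q\<close> be the rank of \<open>y\<close> in the input of level
  \<open>i\<close>, with \<open>2 ^ i * q < 2 * r\<close>. At most \<open>q / k\<close> coins of
  weight \<open>2 ^ i\<close> have variance at most \<open>4 ^ i * q / k\<close>, hence at most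
  \<open>2 ^ i * (2 * r / k)\<close>. There are none unless \<open>q > k * m\<close>, which forces
  the condition of the \<open>if\<close>.\<close>

definition variance_bound :: "nat \<Rightarrow> nat \<Rightarrow> real" where
  "variance_bound r i = (if 2 ^ i * (k * m) < 2 * r then 2 ^ i * (2 * real r / real k) else 0)"

lemma sum_variance_bound_le:
  assumes "r > 0"
  shows "(\<Sum>i<h. variance_bound r i) \<le> 8 * (real r)\<^sup>2 / ((real k)\<^sup>2 * real m)"
proof -
  have mk: "real m > 0" "real k > 0" using m_pos k_pos by auto
  define w where "w = 2 * real r / real k"
  have w: "w > 0" using assms mk by (simp add: w_def)
  define t where "t = 2 * real r / (real k * real m)"
  have t: "t > 0" using assms mk by (simp add: t_def)
  have vb: "variance_bound r i = (if 2 ^ i < t then 2 ^ i * w else 0)" for i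
  proof -
    have "2 ^ i * (k * m) < 2 * r \<longleftrightarrow> real (2 ^ i * (k * m)) < real (2 * r)" by (rule of_nat_less_iff[symmetric])
    also have "\<dots> \<longleftrightarrow> 2 ^ i < t" using mk by (simp add: t_def field_simps)
    finally show ?thesis by (simp add: variance_bound_def w_def)
  qed
  \<comment> \<open>A geometric sum cut off at the threshold \<open>t\<close>. The part
    \<open>2 ^ h\<close> of the minimum carries the induction while the terms are nonzero; the part
    \<open>2 * t\<close> remains after the cut.\<close>
  have "(\<Sum>i<h. variance_bound r i) \<le> min (2 ^ h) (2 * t) * w"
  proof (induction h)
    case (Suc h)
    show ?case
    proof (cases "2 ^ h < t")
      case True
      have "min (2 ^ h) (2 * t) = 2 ^ h" using True t by simp
      then have "(\<Sum>i<Suc h. variance_bound r i) \<le> 2 ^ h * w + 2 ^ h * w"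
        using Suc True by (simp add: vb mult.commute)
      also have "\<dots> = min (2 ^ Suc h) (2 * t) * w" using True by simp
      finally show ?thesis .
    next
      case False
      have "min (2 ^ h) (2 * t) * w \<le> min (2 ^ Suc h) (2 * t) * w"
        using w t by (intro mult_right_mono min.mono) auto
      with Suc False show ?thesis by (simp add: vb)
    qed
  next
    case 0
    have "0 \<le> min 1 (2 * t) * w" using t w by (intro mult_nonneg_nonneg) auto
    then show ?case by simp
  qed
  also have "\<dots> \<le> 2 * t * w" using w by (intro mult_right_mono) auto
  also have "\<dots> = 8 * (real r)\<^sup>2 / ((real k)\<^sup>2 * real m)"
    by (simp add: t_def w_def power2_eq_square)
  finally show ?thesis .
qed

text \<open>Before stopping, the stopped error is the true error of the lower levels and is below
  \<open>a \<le> r\<close>, so the weighted rank of \<open>y\<close> in the input of level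
  \<open>h\<close> is below \<open>2 * r\<close>.\<close>

lemma card_odd_compactions_le:
  assumes "length xs \<le> n" "a \<le> real (item_rank y (mset xs))" "\<bar>stopped_error a xs y \<omega> h\<bar> < a"
  shows "(2 ^ h)\<^sup>2 * real (card (odd_compactions y (level_input k n \<omega> xs h)))
    \<le> variance_bound (item_rank y (mset xs)) h"
proof -
  let ?r = "item_rank y (mset xs)" and ?q = "item_rank y (mset (level_input k n \<omega> xs h))"
  let ?M = "odd_compactions y (level_input k n \<omega> xs h)"
  note M = odd_compactions(3,4)[OF level_input_length_le_n[OF assms(1), of \<omega> h], of y]
  have "2 ^ h * real ?q < 2 * real ?r"
    using item_rank_level_input_le[OF assms(1), of h y \<omega>] stopped_error_cases[of a xs y \<omega> h] assms(2,3)
    by linarith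
  then have "real (2 ^ h * ?q) < real (2 * ?r)" by simp
  then have q: "2 ^ h * ?q < 2 * ?r" by (simp only: of_nat_less_iff)
  show ?thesis
  proof (cases "?q \<le> k * m")
    case True
    then show ?thesis using M(2) by (simp add: variance_bound_def)
  next
    case False
    then have "2 ^ h * (k * m) \<le> 2 ^ h * ?q" by simp
    with q have less: "2 ^ h * (k * m) < 2 * ?r" by linarith
    have "2 ^ h * (k * card ?M) \<le> 2 ^ h * ?q" using M(1) by (rule mult_le_mono2)
    with q have "2 ^ h * (k * card ?M) \<le> 2 * ?r" by linarith
    then have "real (2 ^ h * (k * card ?M)) \<le> real (2 * ?r)" by (simp only: of_nat_le_iff)
    then have "2 ^ h * real (card ?M) \<le> 2 * real ?r / real k"
      using k_pos by (simp add: field_simps)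
    then have "2 ^ h * (2 ^ h * real (card ?M)) \<le> 2 ^ h * (2 * real ?r / real k)"
      by (rule mult_left_mono) simp
    then show ?thesis using less by (simp add: variance_bound_def power2_eq_square)
  qed
qed

text \<open>Each level multiplies the exponential moment by at most \<open>exp (s^2 * v / 2)\<close>
  for its variance bound \<open>v\<close>, since its coins are fresh given the levels below. The
  bound on \<open>h\<close> keeps these coins inside the finite product.\<close>

lemma nn_integral_stopped_error_le:
  fixes xs :: "'a::linorder list"
  assumes "length xs \<le> n" "a \<le> real (item_rank y (mset xs))" "h \<le> Suc (length xs)"
  defines "P \<equiv> Pi_pmf ({..length xs} \<times> {..<length xs}) False (\<lambda>_. bernoulli_pmf (1/2))"
  shows "(\<integral>\<^sup>+ \<omega>. ennreal (exp (s * stopped_error a xs y \<omega> h)) \<partial>P)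
    \<le> ennreal (exp (s\<^sup>2 * (\<Sum>i<h. variance_bound (item_rank y (mset xs)) i) / 2))"
  using assms(3)
proof (induction h)
  case 0
  show ?case by (simp add: measure_pmf.emeasure_space_1)
next
  case (Suc h)
  let ?V = "\<lambda>h. \<Sum>i<h. variance_bound (item_rank y (mset xs)) i"
  \<comment> \<open>The empty set after stopping turns the case distinction into a sum over a random
    set determined by the past.\<close>
  define M where "M \<omega> = (if \<bar>stopped_error a xs y \<omega> h\<bar> < a
    then odd_compactions y (level_input k n \<omega> xs h) else {})" for \<omega>
  define G where "G \<omega> = ennreal (exp (s * stopped_error a xs y \<omega> h))" for \<omega>
  have M_sub: "M \<omega> \<subseteq> {..<length xs}" for \<omega>
    using odd_compactions(1)[OF level_input_length_le_n[OF assms(1), of \<omega> h], of y]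
      length_level_input_le[OF even_k, of n \<omega> xs h]
    by (auto simp: M_def)
  have "exp (s * stopped_error a xs y \<omega> (Suc h)) =
      exp (s * stopped_error a xs y \<omega> h) * exp ((s * 2 ^ h) * (\<Sum>i\<in>M \<omega>. coin_sign (\<omega> (h, i))))" for \<omega>
    by (simp add: M_def level_error_def algebra_simps flip: exp_add)
  then have "(\<integral>\<^sup>+ \<omega>. ennreal (exp (s * stopped_error a xs y \<omega> (Suc h))) \<partial>P)
      = (\<integral>\<^sup>+ \<omega>. G \<omega> * ennreal (exp ((s * 2 ^ h) * (\<Sum>i\<in>M \<omega>. coin_sign (\<omega> (h, i))))) \<partial>P)"
    by (simp add: G_def ennreal_mult)
  also have "\<dots> \<le> (\<integral>\<^sup>+ \<omega>. G \<omega> \<partial>P) * ennreal (exp (s\<^sup>2 * variance_bound (item_rank y (mset xs)) h / 2))"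
    unfolding P_def
  proof (rule nn_integral_fresh_coins_le[where J = "{h} \<times> {..<length xs}"])
    show "finite (M \<omega>)" "Pair h ` M \<omega> \<subseteq> {h} \<times> {..<length xs}" for \<omega>
      using M_sub[of \<omega>] by (auto intro: finite_subset)
    show "(s * 2 ^ h)\<^sup>2 * real (card (M \<omega>)) \<le> s\<^sup>2 * variance_bound (item_rank y (mset xs)) h" for \<omega>
    proof (cases "\<bar>stopped_error a xs y \<omega> h\<bar> < a")
      case True
      from card_odd_compactions_le[OF assms(1,2) this]
      show ?thesis by (simp add: M_def True power_mult_distrib mult.assoc mult_left_mono)
    qed (simp add: M_def variance_bound_def)
    fix \<omega> \<omega>' :: "nat \<times> nat \<Rightarrow> bool"
    assume "\<And>p. p \<notin> {h} \<times> {..<length xs} \<Longrightarrow> \<omega> p = \<omega>' p"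
    then have *: "i < h \<Longrightarrow> \<omega> (i, j) = \<omega>' (i, j)" for i j by simp
    have "stopped_error a xs y \<omega> h = stopped_error a xs y \<omega>' h"
      using * by (rule stopped_error_cong)
    moreover have "level_input k n \<omega> xs h = level_input k n \<omega>' xs h"
      using * even_k by (intro level_input_cong) auto
    ultimately show "G \<omega> = G \<omega>' \<and> M \<omega> = M \<omega>'" by (simp add: G_def M_def)
  qed (use Suc.prems in \<open>auto simp: inj_def\<close>)
  also have "\<dots> \<le> ennreal (exp (s\<^sup>2 * ?V h / 2)) * ennreal (exp (s\<^sup>2 * variance_bound (item_rank y (mset xs)) h / 2))"
    using Suc by (intro mult_right_mono) (auto simp: G_def)
  also have "\<dots> = ennreal (exp (s\<^sup>2 * ?V (Suc h) / 2))"
    by (simp add: algebra_simps add_divide_distrib flip: ennreal_mult exp_add)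
  finally show ?case .
qed

text \<open>Chernoff's bound; the sign \<open>s\<close> covers both tails at once.\<close>

lemma prob_stopped_error_ge:
  fixes xs :: "'a::linorder list"
  assumes "length xs \<le> n" "0 < a" "a \<le> real (item_rank y (mset xs))" "\<bar>s\<bar> = 1"
  defines "P \<equiv> Pi_pmf ({..length xs} \<times> {..<length xs}) False (\<lambda>_. bernoulli_pmf (1/2))"
  defines "V \<equiv> 8 * (real (item_rank y (mset xs)))\<^sup>2 / ((real k)\<^sup>2 * real m)"
  shows "measure_pmf.prob P {\<omega>. a \<le> s * stopped_error a xs y \<omega> (Suc (length xs))} \<le> exp (- a\<^sup>2 / (2 * V))"
proof -
  let ?T = "\<lambda>\<omega>. s * stopped_error a xs y \<omega> (Suc (length xs))"
  let ?W = "\<Sum>i<Suc (length xs). variance_bound (item_rank y (mset xs)) i"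
  have r: "item_rank y (mset xs) > 0" using assms by linarith
  then have V: "V > 0" using k_pos m_pos by (simp add: V_def)
  \<comment> \<open>The minimiser of the exponent \<open>- l * a + l^2 * V / 2\<close>.\<close>
  define l where "l = a / V"
  have l: "l > 0" unfolding l_def using assms(2) V by (rule divide_pos_pos)
  have "emeasure P {\<omega>\<in>UNIV. a \<le> ?T \<omega>} \<le> ennreal (exp (- l * a)) * (\<integral>\<^sup>+ \<omega>. ennreal (exp (l * ?T \<omega>)) * indicator UNIV \<omega> \<partial>P)"
    by (rule Chernoff_ineq_nn_integral_ge[OF l]) auto
  also have "\<dots> = ennreal (exp (- l * a)) * (\<integral>\<^sup>+ \<omega>. ennreal (exp ((l * s) * stopped_error a xs y \<omega> (Suc (length xs)))) \<partial>P)"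
    by (simp only: indicator_UNIV mult_1_right mult.assoc)
  also have "\<dots> \<le> ennreal (exp (- l * a)) * ennreal (exp ((l * s)\<^sup>2 * ?W / 2))"
    unfolding P_def using assms by (intro mult_left_mono nn_integral_stopped_error_le) auto
  also have "\<dots> = ennreal (exp (- l * a + (l * s)\<^sup>2 * ?W / 2))"
    by (simp only: exp_add ennreal_mult'[OF exp_ge_zero])
  also have "\<dots> \<le> ennreal (exp (- l * a + l\<^sup>2 * V / 2))"
  proof -
    have "s\<^sup>2 = 1" using assms(4) power2_abs[of s] by simp
    then have "(l * s)\<^sup>2 * ?W = l\<^sup>2 * ?W" by (simp only: power_mult_distrib mult_1_right)
    also have "\<dots> \<le> l\<^sup>2 * V"
      unfolding V_def by (intro mult_left_mono sum_variance_bound_le r) auto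
    finally show ?thesis by (intro ennreal_leI) (simp del: sum.lessThan_Suc)
  qed
  also have "- l * a + l\<^sup>2 * V / 2 = - a\<^sup>2 / (2 * V)"
    using V by (simp add: l_def power2_eq_square field_simps)
  finally show ?thesis by (simp add: measure_pmf.emeasure_eq_measure)
qed

lemma prob_Err_ge:
  fixes xs :: "'a::linorder list"
  assumes "length xs \<le> n" "0 < item_rank y (mset xs)" "0 < \<epsilon>" "\<epsilon> \<le> 1"
  defines "A \<equiv> {\<omega> \<in> space coin_flips. \<epsilon> * real (item_rank y (mset xs)) \<le> \<bar>Err k n \<omega> xs y\<bar>}"
  shows "A \<in> sets coin_flips"
    and "measure coin_flips A \<le> 2 * exp (- (\<epsilon>\<^sup>2 * (real k)\<^sup>2 * real m / 16))"
proof -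
  define a where "a = \<epsilon> * real (item_rank y (mset xs))"
  let ?I = "{..length xs} \<times> {..<length xs}"
  define P where "P = Pi_pmf ?I False (\<lambda>_. bernoulli_pmf (1/2))"
  define V where "V = 8 * (real (item_rank y (mset xs)))\<^sup>2 / ((real k)\<^sup>2 * real m)"
  have a: "0 < a" "a \<le> real (item_rank y (mset xs))"
    using assms by (auto simp: a_def mult_left_le_one_le)
  have dep: "(a \<le> \<bar>Err k n \<omega> xs y\<bar>) = (a \<le> \<bar>Err k n \<omega>' xs y\<bar>)"
    if "\<And>p. p \<in> ?I \<Longrightarrow> \<omega> p = \<omega>' p" for \<omega> \<omega>'
    using Err_cong[OF even_k, of xs \<omega> \<omega>' n y] that by simp
  have fin: "finite ?I" by simp
  have A: "A = {\<omega> \<in> space coin_flips. a \<le> \<bar>Err k n \<omega> xs y\<bar>}" by (simp add: A_def a_def)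
  show "A \<in> sets coin_flips"
    unfolding A by (rule coin_flips_finite_dependence(1)[OF fin], rule dep, blast)
  let ?T = "\<lambda>\<omega>. stopped_error a xs y \<omega> (Suc (length xs))"
  have "measure coin_flips A = measure_pmf.prob P {\<omega>. a \<le> \<bar>Err k n \<omega> xs y\<bar>}"
    unfolding A P_def by (rule coin_flips_finite_dependence(2)[OF fin], rule dep, blast)
  also have "\<dots> \<le> measure_pmf.prob P ({\<omega>. a \<le> 1 * ?T \<omega>} \<union> {\<omega>. a \<le> - 1 * ?T \<omega>})"
  proof (rule measure_pmf.finite_measure_mono)
    show "{\<omega>. a \<le> \<bar>Err k n \<omega> xs y\<bar>} \<subseteq> {\<omega>. a \<le> 1 * ?T \<omega>} \<union> {\<omega>. a \<le> - 1 * ?T \<omega>}"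
    proof
      fix \<omega> assume "\<omega> \<in> {\<omega>. a \<le> \<bar>Err k n \<omega> xs y\<bar>}"
      then have "a \<le> \<bar>?T \<omega>\<bar>"
        using stopped_error_cases[of a xs y \<omega> "Suc (length xs)"] Err_eq_sum_level_error[OF assms(1), of \<omega> y]
        by auto
      then show "\<omega> \<in> {\<omega>. a \<le> 1 * ?T \<omega>} \<union> {\<omega>. a \<le> - 1 * ?T \<omega>}" by (auto simp: abs_if split: if_splits)
    qed
  qed simp
  also have "\<dots> \<le> measure_pmf.prob P {\<omega>. a \<le> 1 * ?T \<omega>} + measure_pmf.prob P {\<omega>. a \<le> - 1 * ?T \<omega>}"
    by (rule measure_Un_le) auto
  also have "\<dots> \<le> exp (- a\<^sup>2 / (2 * V)) + exp (- a\<^sup>2 / (2 * V))"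
    unfolding P_def V_def by (intro add_mono prob_stopped_error_ge assms(1) a) auto
  also have "- a\<^sup>2 / (2 * V) = - (\<epsilon>\<^sup>2 * (real k)\<^sup>2 * real m / 16)"
    using assms(2) k_pos m_pos by (simp add: a_def V_def field_simps power2_eq_square)
  finally show "measure coin_flips A \<le> 2 * exp (- (\<epsilon>\<^sup>2 * (real k)\<^sup>2 * real m / 16))" by simp
qed

end

subsection \<open>Memory\<close>

lemma int_words_le_1:
  assumes "i \<le> n"
  shows "int_words n i = 1"
proof -
  have "log 2 (real i + 1) \<le> log 2 (real n + 1)" using assms by simp
  then have "log 2 (real i + 1) / log 2 (real n + 1) \<le> 1"
    by (cases "n = 0") (simp_all add: divide_le_eq)
  then have "nat \<lceil>log 2 (real i + 1) / log 2 (real n + 1)\<rceil> \<le> 1"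
    by (simp add: nat_le_iff ceiling_le_iff)
  then show ?thesis by (simp add: int_words_def)
qed

lemma run_output_Nil:
  assumes "size (buffer c) + length xs \<le> capacity k n"
  shows "snd (run k n coins c xs) = []"
  using assms
proof (induction xs arbitrary: c)
  case (Cons x xs)
  then have "arrive k n coins c x = (c\<lparr>buffer := add_mset x (buffer c)\<rparr>, [])"
    by (simp add: arrive_def)
  moreover have "snd (run k n coins (c\<lparr>buffer := add_mset x (buffer c)\<rparr>) xs) = []"
    using Cons.prems by (intro Cons.IH) simp
  ultimately show ?case by (auto split: prod.splits)
qed simp

context sketch_params
begin

lemma compactor_words_le:
  assumes "length xs \<le> n"
  shows "compactor_words k n (level k n \<omega> xs h) \<le> 2 * k * m + 2"
proof -
  have "valid new_compactor (level_input k n \<omega> xs h)"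
    using level_input_length_le_n[OF assms] by (simp add: valid_def new_compactor_def)
  then have v: "valid (level k n \<omega> xs h) []"
    unfolding level_def by (rule valid_run)
  have "state (level k n \<omega> xs h) \<le> k * state (level k n \<omega> xs h)" using k_pos by simp
  also have "\<dots> \<le> n" using v by (simp add: valid_def)
  finally show ?thesis
    using v by (simp add: compactor_words_def valid_def capacity_eq int_words_le_1)
qed

text \<open>Level \<open>h' + 1\<close> receives input only after the buffer of level
  \<open>h'\<close> has been filled, and each item there accounts for \<open>2 ^ h'\<close> items of
  the stream.\<close>

lemma levels_subset:
  assumes "length xs \<le> n" "n < 2 ^ p * (2 * k * m)"
  shows "levels k n \<omega> xs \<subseteq> {..p}"
proof
  fix h assume h: "h \<in> levels k n \<omega> xs"
  show "h \<in> {..p}"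
  proof (cases h)
    case (Suc h')
    then have "snd (run k n (\<lambda>i. \<omega> (h', i)) new_compactor (level_input k n \<omega> xs h')) \<noteq> []"
      using h by (simp add: levels_def)
    then have "\<not> size (buffer (new_compactor :: 'a compactor)) + length (level_input k n \<omega> xs h') \<le> capacity k n"
      using run_output_Nil by blast
    then have "2 * k * m \<le> length (level_input k n \<omega> xs h')"
      by (simp add: new_compactor_def capacity_eq)
    then have "2 ^ h' * (2 * k * m) \<le> 2 ^ h' * length (level_input k n \<omega> xs h')"
      by (rule mult_le_mono2)
    also have "\<dots> \<le> length xs" by (rule length_level_input[OF even_k])
    finally have "2 ^ h' * (2 * k * m) < 2 ^ p * (2 * k * m)" using assms by linarith
    then have "(2::nat) ^ h' < 2 ^ p" by (simp only: mult_less_cancel2)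
    then have "h' < p" by (rule power_less_imp_less_exp[rotated]) simp
    then show ?thesis by (simp add: Suc)
  qed simp
qed

lemma memory_words_le:
  assumes "length xs \<le> n" "n < 2 ^ p * (2 * k * m)" "k \<le> n"
  shows "memory_words k n \<omega> xs \<le> 2 + (p + 1) * (2 * k * m + 2)"
proof -
  have "card (levels k n \<omega> xs) \<le> card {..p}"
    using levels_subset[OF assms(1,2)] by (rule card_mono[rotated]) simp
  then have "card (levels k n \<omega> xs) * (2 * k * m + 2) \<le> (p + 1) * (2 * k * m + 2)"
    by (intro mult_le_mono1) simp
  moreover have "(\<Sum>h\<in>levels k n \<omega> xs. compactor_words k n (level k n \<omega> xs h))
      \<le> (\<Sum>h\<in>levels k n \<omega> xs. 2 * k * m + 2)"
    by (intro sum_mono compactor_words_le assms(1))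
  ultimately show ?thesis
    using assms(3) by (simp add: memory_words_def int_words_le_1)
qed

end

subsection \<open>The choice of the parameters\<close>

locale sketch_accuracy =
  fixes n k :: nat and \<epsilon> \<delta> :: real
  assumes \<delta>: "0 < \<delta>" "\<delta> \<le> 1/2" and \<epsilon>: "0 < \<epsilon>" "\<epsilon> \<le> 1"
    and \<delta>_gt: "\<delta> > 1 / exp (\<epsilon> * real n / 64)"
    and k_eq: "k = 2 * nat \<lceil>4 / \<epsilon> * sqrt (ln (1 / \<delta>) / log 2 (\<epsilon> * real n))\<rceil>"
begin

definition "L = log 2 (\<epsilon> * real n)"
definition "D = ln (1 / \<delta>)"
text \<open>The argument of the ceiling in \<open>k\<close>. The two memory regimes are
  \<open>\<kappa> \<ge> 1\<close>, where \<open>k\<close> is proportional to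
  \<open>\<kappa>\<close>, and \<open>\<kappa> < 1\<close>, where \<open>k = 2\<close>.\<close>

definition "\<kappa> = 4 / \<epsilon> * sqrt (D / L)"
definition "m = nat \<lceil>log 2 (real n / real k)\<rceil>"

lemma D_bounds: "2/3 \<le> D" "64 * D < \<epsilon> * real n"
proof -
  have "ln 2 \<le> D" using \<delta> by (simp add: D_def ln_ge_iff field_simps)
  then show "2/3 \<le> D" using ln2_ge_two_thirds by simp
  have "1 / \<delta> < exp (\<epsilon> * real n / 64)" using \<delta> \<delta>_gt by (simp add: field_simps)
  then have "ln (1 / \<delta>) < ln (exp (\<epsilon> * real n / 64))"
    using \<delta> by (subst ln_less_cancel_iff) auto
  then have "D < \<epsilon> * real n / 64" by (simp add: D_def)
  then show "64 * D < \<epsilon> * real n" by simp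
qed

lemma L_gt: "5 < L"
proof -
  have "2 powr 5 < \<epsilon> * real n" using D_bounds by simp
  then show ?thesis unfolding L_def by (subst less_log_iff) auto
qed

lemma n_pos: "0 < n" using D_bounds by (cases n) auto

lemma \<kappa>_pos: "0 < \<kappa>" using D_bounds L_gt \<epsilon> by (simp add: \<kappa>_def)

lemma k_bounds: "2 * \<kappa> \<le> real k" "real k < 2 * \<kappa> + 2" "2 \<le> k" "\<kappa> < 1 \<Longrightarrow> k = 2" "even k"
proof -
  have k: "k = 2 * nat \<lceil>\<kappa>\<rceil>" by (simp add: k_eq \<kappa>_def D_def L_def)
  have "1 \<le> \<lceil>\<kappa>\<rceil>" using \<kappa>_pos by simp
  then have "1 \<le> nat \<lceil>\<kappa>\<rceil>" "real (nat \<lceil>\<kappa>\<rceil>) = of_int \<lceil>\<kappa>\<rceil>" by linarith+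
  then have *: "real k = 2 * of_int \<lceil>\<kappa>\<rceil>" "2 \<le> k" by (simp_all add: k)
  then show "2 * \<kappa> \<le> real k" "real k < 2 * \<kappa> + 2" "2 \<le> k" by linarith+
  show "even k" by (simp add: k)
  show "k = 2" if "\<kappa> < 1"
  proof -
    have "\<lceil>\<kappa>\<rceil> = 1" using that \<kappa>_pos by (simp add: ceiling_eq_iff)
    then show ?thesis by (simp add: k)
  qed
qed

text \<open>With \<open>t = sqrt (\<epsilon> * n)\<close>, the constant \<open>64\<close> and
  \<open>L > 4\<close> give \<open>D / L \<le> (t / 16)^2\<close>, hence
  \<open>\<epsilon> * \<kappa> \<le> t / 4\<close>. Rounding adds at most
  \<open>2 * \<epsilon>\<close> to \<open>\<epsilon> * k\<close>, and \<open>t \<ge> 4\<close>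
  absorbs it.\<close>

lemma k_le: "real k * sqrt (\<epsilon> * real n) \<le> real n"
proof -
  define t where "t = sqrt (\<epsilon> * real n)"
  have En: "\<epsilon> * real n > 16" using D_bounds by simp
  have t2: "t * t = \<epsilon> * real n" using \<epsilon> by (simp add: t_def)
  have "sqrt 16 \<le> t" unfolding t_def using En by (intro real_sqrt_le_mono) simp
  then have t4: "4 \<le> t" by simp
  have "sqrt (D / L) \<le> t / 16"
  proof (rule real_le_lsqrt)
    have "D / L \<le> D / 4" using L_gt D_bounds by (intro divide_left_mono) auto
    also have "\<dots> \<le> (t / 16)\<^sup>2" using D_bounds t2 by (simp add: power2_eq_square)
    finally show "D / L \<le> (t / 16)\<^sup>2" .
  qed (use t4 in auto)
  then have "\<epsilon> * \<kappa> \<le> t / 4" using \<epsilon> by (simp add: \<kappa>_def)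
  moreover have "\<epsilon> * real k \<le> \<epsilon> * (2 * \<kappa> + 2)" using k_bounds \<epsilon> by (intro mult_left_mono) auto
  ultimately have "\<epsilon> * real k \<le> t / 2 + 2 * \<epsilon>" by (simp add: algebra_simps)
  then have "\<epsilon> * real k \<le> t" using t4 \<epsilon> by linarith
  then have "\<epsilon> * real k * t \<le> t * t" using t4 by (intro mult_right_mono) auto
  then have "\<epsilon> * (real k * t) \<le> \<epsilon> * real n" using t2 by (simp add: mult.assoc)
  then show ?thesis using \<epsilon> by (simp add: t_def)
qed

lemma k_le_n: "k \<le> n"
proof -
  have "1 \<le> sqrt (\<epsilon> * real n)" using D_bounds by simp
  then have "real k * 1 \<le> real k * sqrt (\<epsilon> * real n)" by (intro mult_left_mono) auto
  then show ?thesis using k_le by simp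
qed

lemma log_n_k_ge: "L / 2 \<le> log 2 (real n / real k)"
proof -
  have En: "\<epsilon> * real n > 0" using D_bounds by simp
  have "sqrt (\<epsilon> * real n) \<le> real n / real k" using k_le k_bounds(3) by (simp add: field_simps)
  then have "log 2 (sqrt (\<epsilon> * real n)) \<le> log 2 (real n / real k)"
    using En n_pos k_bounds(3) by (subst log_le_cancel_iff) auto
  then show ?thesis using En by (simp add: L_def log_def ln_sqrt)
qed

text \<open>The capacity involves \<open>n / k\<close>, the memory claim
  \<open>\<epsilon> * n\<close>. As \<open>k\<close> grows like \<open>1 / \<epsilon>\<close> up to
  a factor polynomial in \<open>E = \<epsilon> * n\<close>, the crude estimate
  \<open>L \<le> E\<close> already gives \<open>n / k \<le> E^2\<close>.\<close>

lemma log_n_k_le: "log 2 (real n / real k) \<le> 2 * L"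
proof -
  define E where "E = \<epsilon> * real n"
  have E: "E > 42" using D_bounds by (simp add: E_def)
  have "ln E = ln 2 + ln (E / 2)" using E by (simp add: ln_div)
  moreover have "ln (E / 2) \<le> E / 2 - 1" using E by (intro ln_le_minus_one) simp
  moreover have "ln 2 \<le> (1::real)" using ln_le_minus_one[of 2] by simp
  ultimately have "ln E \<le> E * (1 / 2)" by linarith
  also have "\<dots> \<le> E * ln 2" using E ln2_ge_two_thirds by (intro mult_left_mono) auto
  finally have "L \<le> E" by (simp add: L_def E_def log_def divide_le_eq)
  have "1 / (8 * E) \<le> sqrt (D / L)"
  proof (rule real_le_rsqrt)
    have "(1 / (8 * E))\<^sup>2 = 1 / (64 * E) * (1 / E)" by (simp add: power2_eq_square)
    also have "\<dots> \<le> (1 / 2) * (1 / E)"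
      using E by (intro mult_right_mono) (auto simp: divide_le_eq)
    also have "\<dots> = (1 / 2) / E" by simp
    also have "\<dots> \<le> D / L"
      using D_bounds L_gt \<open>L \<le> E\<close> by (intro frac_le) auto
    finally show "(1 / (8 * E))\<^sup>2 \<le> D / L" .
  qed
  then have "1 / E \<le> \<epsilon> * (2 * \<kappa>)" using \<epsilon> by (simp add: \<kappa>_def)
  also have "\<dots> \<le> \<epsilon> * real k" using k_bounds \<epsilon> by (intro mult_left_mono) auto
  finally have "1 \<le> \<epsilon> * real k * E" using E by (simp add: divide_le_eq)
  then have "real n * 1 \<le> real n * (\<epsilon> * real k * E)" by (intro mult_left_mono) auto
  also have "\<dots> = E\<^sup>2 * real k" by (simp add: E_def power2_eq_square)
  finally have "real n / real k \<le> E\<^sup>2"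
    using k_bounds(3) by (simp add: divide_le_eq)
  then have "log 2 (real n / real k) \<le> log 2 (E\<^sup>2)"
    using n_pos k_bounds(3) E by (subst log_le_cancel_iff) auto
  then show ?thesis using E by (simp add: L_def E_def log_nat_power)
qed

lemma m_bounds: "log 2 (real n / real k) \<le> real m" "L / 2 \<le> real m" "real m \<le> 3 * L" "1 \<le> m"
  using log_n_k_ge log_n_k_le L_gt unfolding m_def by linarith+

sublocale sketch_params k n m
proof
  show "capacity k n = 2 * k * m" by (simp add: capacity_def m_def)
  have "real n / real k \<le> 2 powr real m"
    using m_bounds(1) n_pos k_bounds(3) by (subst (asm) log_le_iff) auto
  then have "real n \<le> real (k * 2 ^ m)"
    using k_bounds(3) by (simp add: field_simps powr_realpow)
  then show "n \<le> k * 2 ^ m" by (simp only: of_nat_le_iff)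
qed (use k_bounds m_bounds in auto)

lemma \<kappa>_squared: "(\<epsilon> * \<kappa>)\<^sup>2 * L = 16 * D"
  using \<epsilon> D_bounds L_gt by (simp add: \<kappa>_def power_mult_distrib)

text \<open>From \<open>k \<ge> 2 * \<kappa>\<close> and \<open>m \<ge> L / 2\<close> the exponent
  is at least \<open>2 * D\<close>, so the bound is at most
  \<open>2 * \<delta>^2 \<le> \<delta>\<close>.\<close>

lemma prob_bound: "2 * exp (- (\<epsilon>\<^sup>2 * (real k)\<^sup>2 * real m / 16)) < 3 * \<delta>"
proof -
  have "4 * (\<epsilon> * \<kappa>)\<^sup>2 = (\<epsilon> * (2 * \<kappa>))\<^sup>2" by (simp add: power2_eq_square)
  also have "\<dots> \<le> (\<epsilon> * real k)\<^sup>2"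
    using k_bounds \<epsilon> \<kappa>_pos by (intro power_mono mult_left_mono) auto
  finally have "4 * (\<epsilon> * \<kappa>)\<^sup>2 * (L / 2) \<le> (\<epsilon> * real k)\<^sup>2 * real m"
    using m_bounds L_gt by (intro mult_mono) auto
  also have "4 * (\<epsilon> * \<kappa>)\<^sup>2 * (L / 2) = 2 * ((\<epsilon> * \<kappa>)\<^sup>2 * L)" by simp
  also have "\<dots> = 32 * D" by (simp only: \<kappa>_squared)
  finally have "2 * D \<le> \<epsilon>\<^sup>2 * (real k)\<^sup>2 * real m / 16"
    by (simp add: power_mult_distrib)
  then have "exp (- (\<epsilon>\<^sup>2 * (real k)\<^sup>2 * real m / 16)) \<le> exp (- (2 * D))" by simp
  also have "\<dots> = \<delta> ^ 2"
    using \<delta> by (simp add: D_def ln_div exp_double)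
  also have "\<dots> \<le> \<delta> * (1/2)" using \<delta> by (simp add: power2_eq_square)
  finally show ?thesis using \<delta> by simp
qed

lemma memory_bound:
  assumes "length xs \<le> n"
  shows "real (memory_words k n \<omega> xs) \<le> 30 * L\<^sup>2 * real k"
proof -
  define p where "p = nat \<lceil>L\<rceil>"
  define B where "B = 2 * real k * real m"
  have p: "L \<le> real p" "real p \<le> L + 1" using L_gt by (auto simp: p_def)
  have "2 * 1 * 1 \<le> B" unfolding B_def
    using k_bounds(3) m_bounds(4) by (intro mult_mono) auto
  then have B2: "2 \<le> B" by simp
  \<comment> \<open>With \<open>\<epsilon> * n = 2 powr L\<close>, this is what makes
    \<open>p = nat \<lceil>L\<rceil>\<close> satisfy \<open>n < 2 ^ p * B\<close>, so that the
    number of levels depends on \<open>\<epsilon> * n\<close> rather than on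
    \<open>n\<close>.\<close>
  have "1 < \<epsilon> * B"
  proof -
    have "1 < 16 * (2/3) * (5::real)" by simp
    also have "\<dots> \<le> 16 * D * L" using D_bounds L_gt by (intro mult_mono) auto
    also have "\<dots> = (\<epsilon> * \<kappa> * L)\<^sup>2"
      unfolding \<kappa>_squared[symmetric] by (simp add: power2_eq_square)
    finally have "1 < \<epsilon> * \<kappa> * L"
      using \<epsilon> \<kappa>_pos L_gt power2_less_imp_less[of 1 "\<epsilon> * \<kappa> * L"] by simp
    also have "\<dots> \<le> 2 * (\<epsilon> * \<kappa> * L)" using \<epsilon> \<kappa>_pos L_gt by simp
    also have "\<dots> = \<epsilon> * (2 * (2 * \<kappa>) * (L / 2))" by simp
    also have "\<dots> \<le> \<epsilon> * B"
      unfolding B_def using \<epsilon> k_bounds m_bounds \<kappa>_pos L_gt by (intro mult_left_mono mult_mono) auto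
    finally show ?thesis .
  qed
  then have "1 / \<epsilon> < B" using \<epsilon> by (simp add: field_simps)
  have "real n < 2 ^ p * B"
  proof -
    have "\<epsilon> * real n = 2 powr L" using D_bounds by (simp add: L_def)
    also have "\<dots> \<le> 2 powr real p" using p by simp
    finally have "\<epsilon> * real n \<le> 2 ^ p" by (simp add: powr_realpow)
    then have "\<epsilon> * real n * (1 / \<epsilon>) < 2 ^ p * B"
      using \<open>1 / \<epsilon> < B\<close> \<epsilon> n_pos B2 by (intro mult_le_less_imp_less) auto
    then show ?thesis using \<epsilon> by simp
  qed
  then have "real n < real (2 ^ p * (2 * k * m))" by (simp add: B_def)
  then have "n < 2 ^ p * (2 * k * m)" by (simp only: of_nat_less_iff)
  from memory_words_le[OF assms this k_le_n]
  have "real (memory_words k n \<omega> xs) \<le> real (2 + (p + 1) * (2 * k * m + 2))"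
    by (simp only: of_nat_le_iff)
  also have "\<dots> = 2 + (real p + 1) * (B + 2)" by (simp add: B_def algebra_simps)
  also have "\<dots> \<le> 2 + (2 * L) * (2 * B)"
    using p L_gt B2 by (intro add_left_mono mult_mono) auto
  also have "\<dots> \<le> 5 * L * B"
  proof -
    have "5 * 2 \<le> L * B" using L_gt B2 by (intro mult_mono) auto
    then show ?thesis by (simp add: algebra_simps)
  qed
  also have "\<dots> \<le> 5 * L * (2 * real k * (3 * L))"
    unfolding B_def using m_bounds L_gt by (intro mult_left_mono) auto
  also have "\<dots> = 30 * L\<^sup>2 * real k" by (simp add: power2_eq_square)
  finally show ?thesis .
qed

end

theorem theorem3:
  "\<exists>K::real. K > 0 \<and> ( \<forall>(n::nat) (\<epsilon>::real) (\<delta>::real) (k::nat) (xs :: 'a::linorder list).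
     length xs \<le> n \<and> 0 < \<delta> \<and> \<delta> \<le> 1/2 \<and> 0 < \<epsilon> \<and> \<epsilon> \<le> 1 \<and> \<delta> > 1 / exp (\<epsilon> * real n / 64) \<and>
     k = 2 * nat \<lceil>4 / \<epsilon> * sqrt (ln (1 / \<delta>) / log 2 (\<epsilon> * real n))\<rceil> \<longrightarrow>
       (\<forall>y. 0 < item_rank y (mset xs) \<longrightarrow>
          {\<omega> \<in> space coin_flips. \<bar>Err k n \<omega> xs y\<bar> \<ge> \<epsilon> * real (item_rank y (mset xs))} \<in> sets coin_flips \<and>
          measure coin_flips
            {\<omega> \<in> space coin_flips. \<bar>Err k n \<omega> xs y\<bar> \<ge> \<epsilon> * real (item_rank y (mset xs))} < 3 * \<delta>) \<and>
       (\<forall>\<omega>. if \<epsilon> \<le> 4 * sqrt (ln (1 / \<delta>) / log 2 (\<epsilon> * real n))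
             then real (memory_words k n \<omega> xs)
                    \<le> K * (1 / \<epsilon> * log 2 (\<epsilon> * real n) powr (3/2) * sqrt (log 2 (1 / \<delta>)))
             else real (memory_words k n \<omega> xs) \<le> K * (log 2 (\<epsilon> * real n))\<^sup>2))"
\<comment> \<open>For \<open>\<kappa> \<ge> 1\<close>, \<open>k \<le> 4 * \<kappa>\<close> and the
  factor \<open>4\<close> in \<open>\<kappa>\<close> turn \<open>30 * L^2 * k\<close> into the
  constant \<open>30 * 4 * 4\<close>; for \<open>k = 2\<close> already \<open>60\<close> would
  do.\<close>
proof (intro exI[of _ 480] conjI allI impI)
  fix n k :: nat and \<epsilon> \<delta> :: real and xs :: "'a list"
  assume asm: "length xs \<le> n \<and> 0 < \<delta> \<and> \<delta> \<le> 1/2 \<and> 0 < \<epsilon> \<and> \<epsilon> \<le> 1 \<and> \<delta> > 1 / exp (\<epsilon> * real n / 64) \<and>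
     k = 2 * nat \<lceil>4 / \<epsilon> * sqrt (ln (1 / \<delta>) / log 2 (\<epsilon> * real n))\<rceil>"
  interpret sketch_accuracy n k \<epsilon> \<delta> using asm by unfold_locales auto
  have len: "length xs \<le> n" using asm by simp
  show "{\<omega> \<in> space coin_flips. \<bar>Err k n \<omega> xs y\<bar> \<ge> \<epsilon> * real (item_rank y (mset xs))} \<in> sets coin_flips"
    if "0 < item_rank y (mset xs)" for y
    using prob_Err_ge(1)[OF len that \<epsilon>] .
  show "measure coin_flips
      {\<omega> \<in> space coin_flips. \<bar>Err k n \<omega> xs y\<bar> \<ge> \<epsilon> * real (item_rank y (mset xs))} < 3 * \<delta>"
    if "0 < item_rank y (mset xs)" for y
    using prob_Err_ge(2)[OF len that \<epsilon>] prob_bound by (rule le_less_trans)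
  fix \<omega> :: "nat \<times> nat \<Rightarrow> bool"
  note memory = memory_bound[OF len, of \<omega>]
  show "if \<epsilon> \<le> 4 * sqrt (ln (1 / \<delta>) / log 2 (\<epsilon> * real n))
    then real (memory_words k n \<omega> xs)
           \<le> 480 * (1 / \<epsilon> * log 2 (\<epsilon> * real n) powr (3/2) * sqrt (log 2 (1 / \<delta>)))
    else real (memory_words k n \<omega> xs) \<le> 480 * (log 2 (\<epsilon> * real n))\<^sup>2"
    unfolding L_def[symmetric] D_def[symmetric]
  proof (cases "\<epsilon> \<le> 4 * sqrt (D / L)")
    case True
    then have "1 \<le> \<kappa>" using \<epsilon> by (simp add: \<kappa>_def pos_le_divide_eq)
    then have "real k \<le> 4 * \<kappa>" using k_bounds(2) by simp
    then have "30 * L\<^sup>2 * real k \<le> 30 * L\<^sup>2 * (4 * \<kappa>)" by (intro mult_left_mono) auto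
    with memory have "real (memory_words k n \<omega> xs) \<le> 30 * L\<^sup>2 * (4 * \<kappa>)" by (rule order_trans)
    also have "\<dots> = 480 * (1 / \<epsilon> * (L * (L * sqrt (D / L))))"
      by (simp add: \<kappa>_def power2_eq_square)
    also have "L * sqrt (D / L) = sqrt L * sqrt D"
    proof -
      have "L * sqrt (D / L) = L / sqrt L * sqrt D" by (simp add: real_sqrt_divide)
      also have "L / sqrt L = sqrt L" using L_gt by (intro real_div_sqrt) simp
      finally show ?thesis .
    qed
    also have "L * (sqrt L * sqrt D) = L powr (3/2) * sqrt D"
      using L_gt powr_add[of L 1 "1/2"] by (simp add: powr_half_sqrt)
    also have "480 * (1 / \<epsilon> * (L powr (3/2) * sqrt D))
        \<le> 480 * (1 / \<epsilon> * (L powr (3/2) * sqrt (log 2 (1 / \<delta>))))"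
    proof -
      have "D * ln 2 \<le> D * 1"
        using D_bounds ln_le_minus_one[of 2] by (intro mult_left_mono) auto
      then have "D \<le> log 2 (1 / \<delta>)" by (simp add: log_def D_def le_divide_eq)
      then show ?thesis using \<epsilon> by (intro mult_left_mono) auto
    qed
    finally show "if \<epsilon> \<le> 4 * sqrt (D / L)
      then real (memory_words k n \<omega> xs) \<le> 480 * (1 / \<epsilon> * L powr (3/2) * sqrt (log 2 (1 / \<delta>)))
      else real (memory_words k n \<omega> xs) \<le> 480 * L\<^sup>2"
      using True by (simp add: mult.assoc)
  next
    case False
    then have "\<kappa> < 1" using \<epsilon> by (simp add: \<kappa>_def pos_divide_less_eq)
    then have "k = 2" by (rule k_bounds(4))
    then have "real (memory_words k n \<omega> xs) \<le> 480 * L\<^sup>2"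
      using memory by simp
    with False show "if \<epsilon> \<le> 4 * sqrt (D / L)
      then real (memory_words k n \<omega> xs) \<le> 480 * (1 / \<epsilon> * L powr (3/2) * sqrt (log 2 (1 / \<delta>)))
      else real (memory_words k n \<omega> xs) \<le> 480 * L\<^sup>2"
      by simp
  qed
qed simp

end
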